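(* Let $H:\mathbb{T}^3\times\mathbb{R}^3\to\mathbb{R}$ be the Hamiltonian $H(\theta,r)=\frac12(r_1^2+r_2^2+r_3^2)$ and let $j:\mathbb{T}^3\to\mathbb{T}^3\times\mathbb{R}^3$ be the embedding $$j(\theta)=(\theta;\cos 2\pi\theta_3,\ \sin 2\pi\theta_3,\ 0).$$ Let $\mathcal{T}=j(\mathbb{T}^3)$. Then: (1) $\mathcal{T}$ is invariant by the Hamiltonian flow of $H$, is not Lagrangian, and has no conjugate points. (2) The example can be modified so that the torus is not a graph: there exist embedded $3$-dimensional tori in $\mathbb{T}^3\times\mathbb{R}^3$, invariant by the Hamiltonian flow of $H$, with no conjugate points, non-Lagrangian and not graphs over $\mathbb{T}^3$, one of them isotopic to $\mathbb{T}^3\times\{0\}$ and another one not isotopic to $\mathbb{T}^3\times\{0\}$. (3) For every symplectic diffeomorphism $f:T^*\mathbb{T}^3\to T^*\mathbb{T}^3$ satisfying $f(\mathcal{T})=\mathcal{T}$, the restriction $f_{|\mathcal{T}}$ is not minimal, i.e. it has at least one non-dense orbit in $\mathcal{T}$.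
   Context: $\mathbb{T}=\mathbb{R}/\mathbb{Z}$, and $T^*\mathbb{T}^3=\mathbb{T}^3\times\mathbb{R}^3$ with coordinates $(\theta,r)=(\theta_1,\theta_2,\theta_3;r_1,r_2,r_3)$ carries its usual symplectic form $\sum_i d\theta_i\wedge dr_i$; $\pi(\theta,r)=\theta$. A submanifold is a graph if it is the image of a section of $\pi$. Let $(\varphi_t)$ be the Hamiltonian flow of $H$ and $V(x)=\ker D\pi(x)$ the vertical subspace at $x$. A $(\varphi_t)$-invariant submanifold has no conjugate points if for every point $x$ of it and every $t\ne0$, $D\varphi_t(V(x))\cap V(\varphi_t(x))=\{0\}$. *)

theory Defs
  imports "HOL-Analysis.Analysis"
begin

quotient_type circle = real / "\<lambda>x y. x - y \<in> \<int>"
proof (rule equivpI)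
  show "reflp (\<lambda>x y::real. x - y \<in> \<int>)"
    by (simp add: reflp_def)
  show "symp (\<lambda>x y::real. x - y \<in> \<int>)"
    by (rule sympI) (metis Ints_minus minus_diff_eq)
  show "transp (\<lambda>x y::real. x - y \<in> \<int>)"
  proof (rule transpI)
    fix x y z :: real
    assume "x - y \<in> \<int>" "y - z \<in> \<int>"
    then have "(x - y) + (y - z) \<in> \<int>" by (rule Ints_add)
    then show "x - z \<in> \<int>" by simp
  qed
qed

instantiation circle :: topological_space
begin

definition open_circle :: "circle set \<Rightarrow> bool" where
  "open_circle U \<longleftrightarrow> open (abs_circle -` U)"

instance
  by standard (auto simp: open_circle_def vimage_Union)

end

lift_definition cos_2pi :: "circle \<Rightarrow> real" is "\<lambda>x. cos (2 * pi * x)"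
proof -
  fix x y :: real
  assume "x - y \<in> \<int>"
  then obtain n where "x - y = of_int n" by (auto elim: Ints_cases)
  then have "x = y + of_int n" by simp
  then have "2 * pi * x = 2 * pi * y + 2 * pi * of_int n"
    by (simp only: distrib_left)
  then show "cos (2 * pi * x) = cos (2 * pi * y)"
    by (simp add: cos_add)
qed

lift_definition sin_2pi :: "circle \<Rightarrow> real" is "\<lambda>x. sin (2 * pi * x)"
proof -
  fix x y :: real
  assume "x - y \<in> \<int>"
  then obtain n where "x - y = of_int n" by (auto elim: Ints_cases)
  then have "x = y + of_int n" by simp
  then have "2 * pi * x = 2 * pi * y + 2 * pi * of_int n"
    by (simp only: distrib_left)
  then show "sin (2 * pi * x) = sin (2 * pi * y)"
    by (simp add: sin_add)
qed

type_synonym torus3 = "circle ^ 3"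
type_synonym phase = "torus3 \<times> (real ^ 3)"
type_synonym phase_vec = "(real ^ 3) \<times> (real ^ 3)"

definition torus_cover :: "real ^ 3 \<Rightarrow> torus3" where
  "torus_cover x = (\<chi> i. abs_circle (x $ i))"

definition phase_cover :: "phase_vec \<Rightarrow> phase" where
  "phase_cover = map_prod torus_cover id"

text \<open>
  The manifolds involved are all of the form E / L for a Euclidean space E and a discrete
  group L of translations: the real line, the torus, the phase space, and the product of the
  line with the torus. Such a manifold is presented by its covering map; the local inverses
  of the covering map are the charts, and the differential of the covering map identifies
  every tangent space with E. In the following, p and q are the covering maps of the source
  and of the target, and F is a representative of f in such charts.
\<close>

definition has_mderiv ::
  "('a::euclidean_space \<Rightarrow> 'm) \<Rightarrow> ('b::euclidean_space \<Rightarrow> 'n) \<Rightarrow> ('m \<Rightarrow> 'n) \<Rightarrow> 'm \<Rightarrow> ('a \<Rightarrow> 'b) \<Rightarrow> bool"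
  where
  "has_mderiv p q f x A \<longleftrightarrow>
     (\<exists>F a. p a = x \<and> (\<forall>\<^sub>F y in nhds a. q (F y) = f (p y)) \<and> (F has_derivative A) (at a))"

definition mderiv ::
  "('a::euclidean_space \<Rightarrow> 'm) \<Rightarrow> ('b::euclidean_space \<Rightarrow> 'n) \<Rightarrow> ('m \<Rightarrow> 'n) \<Rightarrow> 'm \<Rightarrow> 'a \<Rightarrow> 'b"
  where
  "mderiv p q f x = (THE A. has_mderiv p q f x A)"

text \<open>
  Class C^k on an open set U. In finite dimension, continuity of the derivative is continuity of
  all directional derivatives.
\<close>

primrec Ck_on ::
  "nat \<Rightarrow> 'a::euclidean_space set \<Rightarrow> ('a \<Rightarrow> 'b::euclidean_space) \<Rightarrow> bool" where
  "Ck_on 0 U F \<longleftrightarrow> continuous_on U F"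
| "Ck_on (Suc k) U F \<longleftrightarrow>
     (\<exists>F'. (\<forall>x\<in>U. (F has_derivative F' x) (at x)) \<and> (\<forall>v. Ck_on k U (\<lambda>x. F' x v)))"

definition smooth_map ::
  "('a::euclidean_space \<Rightarrow> 'm) \<Rightarrow> ('b::euclidean_space \<Rightarrow> 'n) \<Rightarrow> ('m \<Rightarrow> 'n) \<Rightarrow> bool" where
  "smooth_map p q f \<longleftrightarrow>
     (\<forall>a. \<exists>U F. open U \<and> a \<in> U \<and> (\<forall>k. Ck_on k U F) \<and> (\<forall>y\<in>U. q (F y) = f (p y)))"

definition omega :: "phase_vec \<Rightarrow> phase_vec \<Rightarrow> real" where
  "omega X Y = (\<Sum>i\<in>UNIV. fst X $ i * snd Y $ i - snd X $ i * fst Y $ i)"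

definition velocity :: "(real \<Rightarrow> phase) \<Rightarrow> real \<Rightarrow> phase_vec" where
  "velocity c t = mderiv id phase_cover c t 1"

text \<open>
  The Hamiltonian vector field X satisfies omega(X, w) = dH(w), which in coordinates gives
  theta' = dH/dr and r' = - dH/dtheta.
\<close>

definition is_hamiltonian_flow :: "(phase \<Rightarrow> real) \<Rightarrow> (real \<Rightarrow> phase \<Rightarrow> phase) \<Rightarrow> bool" where
  "is_hamiltonian_flow H \<phi> \<longleftrightarrow>
     (\<forall>x. \<phi> 0 x = x) \<and>
     (\<forall>x t. \<exists>X. has_mderiv id phase_cover (\<lambda>s. \<phi> s x) t (\<lambda>h. h *\<^sub>R X) \<and>
        (\<forall>w. omega X w = mderiv phase_cover id H (\<phi> t x) w))"

definition hamiltonian_flow :: "(phase \<Rightarrow> real) \<Rightarrow> real \<Rightarrow> phase \<Rightarrow> phase" where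
  "hamiltonian_flow H = (THE \<phi>. is_hamiltonian_flow H \<phi>)"

definition flow_invariant :: "(real \<Rightarrow> phase \<Rightarrow> phase) \<Rightarrow> phase set \<Rightarrow> bool" where
  "flow_invariant \<phi> S \<longleftrightarrow> (\<forall>t. \<phi> t ` S = S)"

definition vertical :: "phase \<Rightarrow> phase_vec set" where
  "vertical x = {v. mderiv phase_cover torus_cover fst x v = 0}"

definition no_conjugate_points :: "(real \<Rightarrow> phase \<Rightarrow> phase) \<Rightarrow> phase set \<Rightarrow> bool" where
  "no_conjugate_points \<phi> S \<longleftrightarrow>
     (\<forall>x\<in>S. \<forall>t. t \<noteq> 0 \<longrightarrow>
        mderiv phase_cover phase_cover (\<phi> t) x ` vertical x \<inter> vertical (\<phi> t x) = {0})"

definition torus_embedding :: "(torus3 \<Rightarrow> phase) \<Rightarrow> bool" where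
  "torus_embedding k \<longleftrightarrow>
     smooth_map torus_cover phase_cover k \<and>
     (\<forall>\<theta>. inj (mderiv torus_cover phase_cover k \<theta>)) \<and>
     homeomorphism UNIV (range k) k (inv k)"

definition embedded_torus :: "phase set \<Rightarrow> bool" where
  "embedded_torus S \<longleftrightarrow> (\<exists>k. torus_embedding k \<and> S = range k)"

definition tangent_space :: "phase set \<Rightarrow> phase \<Rightarrow> phase_vec set" where
  "tangent_space S x =
     {velocity c 0 | c. smooth_map id phase_cover c \<and> range c \<subseteq> S \<and> c 0 = x}"

definition lagrangian :: "phase set \<Rightarrow> bool" where
  "lagrangian S \<longleftrightarrow>
     (\<forall>x\<in>S. dim (tangent_space S x) = 3 \<and>
        (\<forall>X\<in>tangent_space S x. \<forall>Y\<in>tangent_space S x. omega X Y = 0))"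

definition is_graph :: "phase set \<Rightarrow> bool" where
  "is_graph S \<longleftrightarrow>
     (\<exists>\<sigma>. continuous_on UNIV \<sigma> \<and> (\<forall>\<theta>. fst (\<sigma> \<theta>) = \<theta>) \<and> S = range \<sigma>)"

text \<open>
  Smooth isotopy through embeddings. Only the times in [0, 1] matter; asking for smoothness on
  the whole line is no restriction, since the time can be reparametrized.
\<close>

definition isotopic_tori :: "phase set \<Rightarrow> phase set \<Rightarrow> bool" where
  "isotopic_tori S S' \<longleftrightarrow>
     (\<exists>F :: real \<Rightarrow> torus3 \<Rightarrow> phase.
        smooth_map (map_prod id torus_cover) phase_cover (\<lambda>(s, \<theta>). F s \<theta>) \<and>
        (\<forall>s\<in>{0..1}. torus_embedding (F s)) \<and>
        range (F 0) = S \<and> range (F 1) = S')"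

definition zero_section :: "phase set" where
  "zero_section = UNIV \<times> {0}"

definition symplectic_diffeo :: "(phase \<Rightarrow> phase) \<Rightarrow> bool" where
  "symplectic_diffeo f \<longleftrightarrow>
     bij f \<and> smooth_map phase_cover phase_cover f \<and>
     smooth_map phase_cover phase_cover (inv f) \<and>
     (\<forall>x X Y. omega (mderiv phase_cover phase_cover f x X) (mderiv phase_cover phase_cover f x Y)
        = omega X Y)"

definition orbit :: "('a \<Rightarrow> 'a) \<Rightarrow> 'a \<Rightarrow> 'a set" where
  "orbit f x = range (\<lambda>n. (f ^^ n) x) \<union> range (\<lambda>n. (inv f ^^ n) x)"

text \<open>Meant for a bijection f with f(S) = S; the orbits of points of S then stay in S.\<close>

definition minimal_on :: "('a::topological_space \<Rightarrow> 'a) \<Rightarrow> 'a set \<Rightarrow> bool" where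
  "minimal_on f S \<longleftrightarrow> (\<forall>x\<in>S. S \<subseteq> closure (orbit f x))"

definition kinetic :: "phase \<Rightarrow> real" where
  "kinetic x = ((snd x $ 1)\<^sup>2 + (snd x $ 2)\<^sup>2 + (snd x $ 3)\<^sup>2) / 2"

definition helix :: "torus3 \<Rightarrow> phase" where
  "helix \<theta> = (\<theta>, vector [cos_2pi (\<theta> $ 3), sin_2pi (\<theta> $ 3), 0])"

definition helix_torus :: "phase set" where
  "helix_torus = range helix"

end

(*
  All tori in question belong to one family: with the third angle s, the point
  (theta_1, theta_2, a s + c sin 2 pi s; b cos 2 pi s, b sin 2 pi s, 0). Since r_3 = 0, the flow
  translates the first two angles only.

  If the third angle is constant on a torus, then along an isotopy starting there it stays
  null-homotopic, so the torus is not isotopic to the zero section.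

  For (3), lift f restricted to the torus to G on R^3. The restricted symplectic form has the
  kernel spanned by r = (cos 2 pi s, sin 2 pi s, 0), so G maps lines in direction r to lines in
  the direction r of the image point. On the other hand, G is at bounded distance from a linear
  map A in GL_2(Z) along such lines, so A maps the directions r to each other. A matrix in
  GL_2(Z) has a finite invariant set of directions: an eigenvector, or a periodic orbit if A is
  elliptic. The points of the torus whose direction lies in this set form a proper closed
  invariant subset.
*)

theory Submission
  imports Defs
begin

subsection \<open>Covering maps and differentials\<close>

text \<open>The columns of the matrix \<open>A\<close> are the increments of \<open>G\<close> under
  the first two lattice translations. They are constant in x while the heading runs over the circle,
  and this forces their third entries to vanish; the lift of the inverse of \<open>f\<close>
  supplies the inverse matrix. After subtraction of the linear part, \<open>G\<close> is periodic in
  the first two coordinates, hence bounded on each slice where the third one is fixed, and a line in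
  a heading direction stays in such a slice. Lifting gives only continuity of \<open>G\<close>;
  differentiability is recovered by comparison with smooth local representatives of
  \<open>f\<close>, since two local lifts differ by a constant when the fibres are discrete. In (2),
  \<open>coil 1 (1/4) 1\<close> folds over the third angle without changing the degree, so it can be
  shrunk to the zero section, while \<open>coil 0 0 1\<close> collapses the third angle to a
  constant. Absence of conjugate points holds on the whole phase space: a vertical vector (0, v)
  goes to (t v, v).\<close>

lemma abs_circle_eq_iff: "abs_circle x = abs_circle y \<longleftrightarrow> x - y \<in> \<int>"
  by (rule circle.abs_eq_iff)

lemma circle_cases:
  fixes z :: circle
  obtains x where "z = abs_circle x"
  by (metis Quotient3_abs_rep Quotient3_circle)

lemma continuous_on_abs_circle: "continuous_on UNIV abs_circle"
  by (simp add: continuous_on_open_vimage open_circle_def)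

lemma continuous_on_circleI:
  assumes "continuous_on UNIV (\<lambda>x. f (abs_circle x))"
  shows "continuous_on UNIV f"
  using assms by (simp add: continuous_on_open_vimage open_circle_def vimage_def)

lemma cos_2pi_abs_circle [simp]: "cos_2pi (abs_circle x) = cos (2 * pi * x)"
  by (rule cos_2pi.abs_eq)

lemma sin_2pi_abs_circle [simp]: "sin_2pi (abs_circle x) = sin (2 * pi * x)"
  by (rule sin_2pi.abs_eq)

lemma continuous_on_cos_2pi: "continuous_on UNIV cos_2pi"
  by (rule continuous_on_circleI) (simp, intro continuous_intros)

lemma continuous_on_sin_2pi: "continuous_on UNIV sin_2pi"
  by (rule continuous_on_circleI) (simp, intro continuous_intros)

text \<open>Cosine and sine embed the circle in the plane, so equality of angles becomes equality of
  globally defined real functions. Flow uniqueness, injectivity of the coils and the lifting of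
  circle-valued maps all use this.\<close>

lemma circle_eqI:
  assumes "cos_2pi z = cos_2pi w" "sin_2pi z = sin_2pi w"
  shows "z = w"
proof -
  obtain x y where [simp]: "z = abs_circle x" "w = abs_circle y"
    by (metis circle_cases)
  obtain n :: int where "2 * pi * x = 2 * pi * y + 2 * pi * n"
    using assms sin_cos_eq_iff[of "2 * pi * x" "2 * pi * y"] by auto
  then have "2 * pi * x = 2 * pi * (y + n)"
    by (simp add: algebra_simps)
  then have "x - y = n" by simp
  then show ?thesis by (simp add: abs_circle_eq_iff)
qed

lemma torus_cover_nth [simp]: "torus_cover x $ i = abs_circle (x $ i)"
  by (simp add: torus_cover_def)

lemma torus_cover_eq_iff: "torus_cover x = torus_cover y \<longleftrightarrow> (\<forall>i. x $ i - y $ i \<in> \<int>)"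
  by (simp add: vec_eq_iff abs_circle_eq_iff)

lemma torus_cases:
  fixes \<theta> :: torus3
  obtains x where "\<theta> = torus_cover x"
proof -
  have "\<forall>i. \<exists>x. \<theta> $ i = abs_circle x"
    by (metis circle_cases)
  then obtain x where "\<forall>i. \<theta> $ i = abs_circle (x i)"
    by metis
  then have "\<theta> = torus_cover (\<chi> i. x i)"
    by (simp add: vec_eq_iff)
  then show ?thesis by (rule that)
qed

lemma continuous_on_vecI:
  fixes f :: "'a::topological_space \<Rightarrow> ('b::topological_space)^'n::finite"
  assumes "\<And>i. continuous_on S (\<lambda>x. f x $ i)"
  shows "continuous_on S f"
  using assms by (auto simp: continuous_on_def intro!: vec_tendstoI)

lemma continuous_on_torus_cover: "continuous_on UNIV torus_cover"
proof (rule continuous_on_vecI)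
  fix i
  show "continuous_on UNIV (\<lambda>x. torus_cover x $ i)"
    unfolding torus_cover_nth
    by (rule continuous_on_compose2[OF continuous_on_abs_circle])
       (auto intro: continuous_on_component)
qed

lemma compact_torus: "compact (UNIV :: torus3 set)"
proof -
  have "\<theta> \<in> torus_cover ` cbox 0 (\<chi> i. 1)" for \<theta> :: torus3
  proof -
    obtain x where x: "\<theta> = torus_cover x" by (rule torus_cases)
    have "\<theta> = torus_cover (\<chi> i. frac (x $ i))"
      unfolding x torus_cover_eq_iff by (simp add: frac_def)
    moreover have "(\<chi> i. frac (x $ i)) \<in> cbox 0 (\<chi> i. 1)"
      by (simp add: mem_box_cart less_imp_le frac_lt_1)
    ultimately show ?thesis by blast
  qed
  then have "(UNIV :: torus3 set) = torus_cover ` cbox 0 (\<chi> i. 1)"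
    by blast
  then show ?thesis
    using compact_continuous_image[OF continuous_on_subset[OF continuous_on_torus_cover subset_UNIV]
        compact_cbox] by metis
qed

lemma phase_cover_Pair [simp]: "phase_cover (x, r) = (torus_cover x, r)"
  by (simp add: phase_cover_def)

lemma fst_phase_cover [simp]: "fst (phase_cover y) = torus_cover (fst y)"
  and snd_phase_cover [simp]: "snd (phase_cover y) = snd y"
  by (simp_all add: phase_cover_def)

lemma phase_cases:
  fixes z :: phase
  obtains y where "z = phase_cover y"
  by (metis torus_cases phase_cover_Pair surj_pair)

lemma continuous_on_phase_cover: "continuous_on UNIV phase_cover"
proof -
  have "continuous_on UNIV (\<lambda>y::phase_vec. (torus_cover (fst y), snd y))"
    by (intro continuous_on_Pair continuous_on_compose2[OF continuous_on_torus_cover]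
        continuous_on_fst continuous_on_snd continuous_on_id) auto
  then show ?thesis
    by (simp add: phase_cover_def map_prod_def case_prod_beta)
qed

text \<open>
  The fibres are cosets of a group of translations whose nonzero elements are bounded away
  from zero.
\<close>

definition lattice_cover :: "('a::euclidean_space \<Rightarrow> 'm) \<Rightarrow> bool" where
  "lattice_cover p \<longleftrightarrow>
     (\<forall>a b. p a = p b \<longrightarrow> (\<forall>y. p (y + (b - a)) = p y)) \<and>
     (\<exists>\<epsilon>>0. \<forall>a b. p a = p b \<longrightarrow> dist a b < \<epsilon> \<longrightarrow> a = b)"

lemma lattice_cover_id: "lattice_cover id"
  unfolding lattice_cover_def by (auto intro!: exI[of _ 1])

lemma Ints_small_eq_0: "x \<in> \<int> \<Longrightarrow> \<bar>x\<bar> < (1::real) \<Longrightarrow> x = 0"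
  by (auto elim!: Ints_cases)

lemma torus_cover_dist:
  assumes "torus_cover a = torus_cover b" "dist a b < 1"
  shows "a = b"
proof -
  have "\<bar>a $ i - b $ i\<bar> < 1" for i
    using assms(2) component_le_norm_cart[of "a - b" i] by (simp add: dist_norm)
  then have "a $ i - b $ i = 0" for i
    using assms(1) by (intro Ints_small_eq_0) (auto simp: torus_cover_eq_iff)
  then show ?thesis
    by (simp add: vec_eq_iff)
qed

lemma torus_cover_translate:
  assumes "torus_cover a = torus_cover b"
  shows "torus_cover (y + (b - a)) = torus_cover y"
  using assms unfolding torus_cover_eq_iff by simp (metis Ints_minus minus_diff_eq)

lemma lattice_cover_torus: "lattice_cover torus_cover"
  unfolding lattice_cover_def
  by (auto intro!: exI[of _ 1] simp: torus_cover_dist torus_cover_translate)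

lemma lattice_cover_phase: "lattice_cover phase_cover"
proof -
  have "a = b" if "phase_cover a = phase_cover b" "dist a b < 1" for a b
  proof -
    have "torus_cover (fst a) = torus_cover (fst b)" "snd a = snd b"
      using that(1) by (simp_all add: phase_cover_def prod_eq_iff map_prod_def case_prod_beta)
    moreover have "dist (fst a) (fst b) < 1"
      using that(2) dist_fst_le le_less_trans by blast
    ultimately show ?thesis
      using torus_cover_dist prod_eqI by blast
  qed
  moreover have "phase_cover (y + (b - a)) = phase_cover y" if "phase_cover a = phase_cover b" for a b y
  proof -
    have "torus_cover (fst a) = torus_cover (fst b)" "snd a = snd b"
      using that by (simp_all add: phase_cover_def prod_eq_iff map_prod_def case_prod_beta)
    then show ?thesis
      by (simp add: prod_eq_iff torus_cover_translate)
  qed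
  ultimately show ?thesis
    unfolding lattice_cover_def by (auto intro!: exI[of _ 1])
qed

lemma lattice_cover_translate:
  assumes "lattice_cover p" "p a = p b"
  shows "p (y + (b - a)) = p y"
  using assms unfolding lattice_cover_def by simp

text \<open>The difference of the values at \<open>a\<close> is a period, so the translated
  \<open>F'\<close> is again a lift, now with the same value as \<open>F\<close> at
  \<open>a\<close>. Near \<open>a\<close> the two stay closer than the gap of the lattice, hence
  coincide.\<close>

lemma local_lifts_differ_by_constant:
  assumes "lattice_cover q" "isCont F a" "isCont F' a"
    and ev: "\<forall>\<^sub>F y in nhds a. q (F y) = q (F' y)"
  shows "\<forall>\<^sub>F y in nhds a. F y = F' y + (F a - F' a)"
proof -
  obtain \<epsilon> where \<epsilon>: "\<epsilon> > 0" "\<And>u v. q u = q v \<Longrightarrow> dist u v < \<epsilon> \<Longrightarrow> u = v"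
    using assms(1) unfolding lattice_cover_def by metis
  have qa: "q (F' a) = q (F a)"
    using eventually_nhds_x_imp_x[OF ev] by simp
  have tr: "q (z + (F a - F' a)) = q z" for z
    by (rule lattice_cover_translate[OF assms(1) qa])
  have "((\<lambda>y. dist (F y) (F' y + (F a - F' a))) \<longlongrightarrow> dist (F a) (F' a + (F a - F' a))) (nhds a)"
    using assms(2,3) unfolding continuous_at by (intro tendsto_intros) (auto simp: tendsto_at_iff_tendsto_nhds)
  then have "\<forall>\<^sub>F y in nhds a. dist (F y) (F' y + (F a - F' a)) < \<epsilon>"
    using \<epsilon>(1) by (intro order_tendstoD(2)[where y = "dist (F a) (F' a + (F a - F' a))"]) auto
  with ev show ?thesis
    by eventually_elim (use \<epsilon>(2) tr in metis)
qed

text \<open>The two representatives may be centred at different points over \<open>x\<close>.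
  Translation by the period \<open>l\<close> recentres the second one at \<open>a\<close>; there the
  lifts differ by a constant, which the derivative does not see.\<close>

lemma has_mderiv_unique:
  assumes "lattice_cover p" "lattice_cover q"
    and "has_mderiv p q f x A" "has_mderiv p q f x A'"
  shows "A = A'"
proof -
  obtain F a where F: "p a = x" "\<forall>\<^sub>F y in nhds a. q (F y) = f (p y)" "(F has_derivative A) (at a)"
    using assms(3) unfolding has_mderiv_def by blast
  obtain F' b where F': "p b = x" "\<forall>\<^sub>F y in nhds b. q (F' y) = f (p y)" "(F' has_derivative A') (at b)"
    using assms(4) unfolding has_mderiv_def by blast
  define l where "l = b - a"
  have tr: "p (y + l) = p y" for y
    using lattice_cover_translate[OF assms(1), of a b] F(1) F'(1) by (simp add: l_def)
  have "((\<lambda>y. y + l) \<longlongrightarrow> a + l) (nhds a)"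
    by (intro tendsto_intros) (simp add: filterlim_def)
  then have "filterlim (\<lambda>y. y + l) (nhds b) (nhds a)"
    by (simp add: l_def)
  then have "\<forall>\<^sub>F y in nhds a. q (F' (y + l)) = f (p (y + l))"
    using F'(2) by (auto simp: filterlim_iff)
  then have ev: "\<forall>\<^sub>F y in nhds a. q (F y) = q (F' (y + l))"
    using F(2) by eventually_elim (simp add: tr)
  have D': "((\<lambda>y. F' (y + l)) has_derivative A') (at a)"
  proof -
    have "(F' has_derivative A') (at (a + l))" using F'(3) by (simp add: l_def)
    moreover have "((\<lambda>y. y + l) has_derivative (\<lambda>h. h)) (at a)"
      by (auto intro!: derivative_eq_intros)
    ultimately show ?thesis
      using has_derivative_compose[of "\<lambda>y. y + l" "\<lambda>h. h" a UNIV F' A'] by simp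
  qed
  have "\<forall>\<^sub>F y in nhds a. F y = F' (y + l) + (F a - F' (a + l))"
    using local_lifts_differ_by_constant[OF assms(2) has_derivative_continuous[OF F(3)]
        has_derivative_continuous[OF D'] ev] .
  then have "\<forall>\<^sub>F y in at a. F' (y + l) + (F a - F' (a + l)) = F y"
    unfolding eventually_nhds_conv_at by (auto elim: eventually_mono)
  moreover have "((\<lambda>y. F' (y + l) + (F a - F' (a + l))) has_derivative A') (at a)"
    using D' by (auto intro!: derivative_eq_intros)
  ultimately have "(F has_derivative A') (at a)"
    using has_derivative_transform_eventually[of "\<lambda>y. F' (y + l) + (F a - F' (a + l))" A' a UNIV F]
    by simp
  then show ?thesis
    using F(3) has_derivative_unique by blast
qed

lemma mderiv_eqI:
  assumes "lattice_cover p" "lattice_cover q" "has_mderiv p q f x A"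
  shows "mderiv p q f x = A"
  unfolding mderiv_def
  using assms has_mderiv_unique[OF assms(1,2)] by (intro the_equality) auto

lemma has_mderivI:
  assumes "\<And>y. q (F y) = f (p y)" "(F has_derivative A) (at a)"
  shows "has_mderiv p q f (p a) A"
  unfolding has_mderiv_def using assms by (intro exI[of _ F] exI[of _ a]) auto

subsection \<open>Smoothness and the family of tori\<close>

lemma Ck_on_const [intro]: "Ck_on k U (\<lambda>x. c)"
proof (induction k arbitrary: c)
  case (Suc k)
  then show ?case by (auto intro!: exI[of _ "\<lambda>_ _. 0"])
qed simp

lemma Ck_on_bounded_linear:
  assumes "bounded_linear f"
  shows "Ck_on k U f"
proof (cases k)
  case 0
  then show ?thesis
    using assms by (simp add: linear_continuous_on)
next
  case (Suc n)
  then show ?thesis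
    using assms by (auto intro!: exI[of _ "\<lambda>_. f"] bounded_linear_imp_has_derivative)
qed

lemma Ck_on_SucD: "Ck_on (Suc k) U f \<Longrightarrow> Ck_on k U f"
proof (induction k arbitrary: f)
  case 0
  then show ?case
    by (auto intro!: continuous_at_imp_continuous_on elim!: has_derivative_continuous)
next
  case (Suc k)
  obtain F' where "\<forall>x\<in>U. (f has_derivative F' x) (at x)" "\<forall>v. Ck_on (Suc k) U (\<lambda>x. F' x v)"
    using Suc.prems unfolding Ck_on.simps(2)[of "Suc k"] by blast
  then show ?case
    using Suc.IH by auto
qed

lemma Ck_on_add:
  "Ck_on k U f \<Longrightarrow> Ck_on k U g \<Longrightarrow> Ck_on k U (\<lambda>x. f x + g x)"
proof (induction k arbitrary: f g)
  case 0
  then show ?case by (simp add: continuous_on_add)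
next
  case (Suc k)
  obtain F' where F: "\<forall>x\<in>U. (f has_derivative F' x) (at x)" "\<forall>v. Ck_on k U (\<lambda>x. F' x v)"
    using Suc.prems by auto
  obtain G' where G: "\<forall>x\<in>U. (g has_derivative G' x) (at x)" "\<forall>v. Ck_on k U (\<lambda>x. G' x v)"
    using Suc.prems by auto
  show ?case
    using F G Suc.IH by (auto intro!: exI[of _ "\<lambda>x v. F' x v + G' x v"] has_derivative_add)
qed

lemma Ck_on_mult:
  fixes f g :: "'a::euclidean_space \<Rightarrow> real"
  shows "Ck_on k U f \<Longrightarrow> Ck_on k U g \<Longrightarrow> Ck_on k U (\<lambda>x. f x * g x)"
proof (induction k arbitrary: f g)
  case 0
  then show ?case by (simp add: continuous_on_mult)
next
  case (Suc k)
  obtain F' where F: "\<forall>x\<in>U. (f has_derivative F' x) (at x)" "\<forall>v. Ck_on k U (\<lambda>x. F' x v)"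
    using Suc.prems by auto
  obtain G' where G: "\<forall>x\<in>U. (g has_derivative G' x) (at x)" "\<forall>v. Ck_on k U (\<lambda>x. G' x v)"
    using Suc.prems by auto
  have "Ck_on k U f" "Ck_on k U g"
    using Suc.prems Ck_on_SucD by blast+
  then show ?case
    using F G Suc.IH
    by (auto intro!: exI[of _ "\<lambda>x v. f x * G' x v + F' x v * g x"] has_derivative_mult Ck_on_add)
qed

text \<open>Sine and cosine are treated together because each occurs in the derivative of the other,
  so neither induction closes alone.\<close>

lemma Ck_on_sin_cos:
  fixes f :: "'a::euclidean_space \<Rightarrow> real"
  shows "Ck_on k U f \<Longrightarrow> Ck_on k U (\<lambda>x. sin (f x)) \<and> Ck_on k U (\<lambda>x. cos (f x))"
proof (induction k)
  case 0
  then show ?case by (simp add: continuous_on_sin continuous_on_cos)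
next
  case (Suc k)
  obtain F' where F: "\<forall>x\<in>U. (f has_derivative F' x) (at x)" "\<forall>v. Ck_on k U (\<lambda>x. F' x v)"
    using Suc.prems by auto
  have *: "Ck_on k U (\<lambda>x. sin (f x))" "Ck_on k U (\<lambda>x. cos (f x))"
    using Suc.IH Suc.prems Ck_on_SucD by blast+
  have "Ck_on (Suc k) U (\<lambda>x. sin (f x))"
    unfolding Ck_on.simps
  proof (intro exI conjI ballI allI)
    show "((\<lambda>x. sin (f x)) has_derivative (\<lambda>v. cos (f x) * F' x v)) (at x)" if "x \<in> U" for x
      using F(1) that by (auto intro!: derivative_eq_intros)
    show "Ck_on k U (\<lambda>x. cos (f x) * F' x v)" for v
      using F(2) * by (simp add: Ck_on_mult)
  qed
  moreover have "Ck_on (Suc k) U (\<lambda>x. cos (f x))"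
    unfolding Ck_on.simps
  proof (intro exI conjI ballI allI)
    show "((\<lambda>x. cos (f x)) has_derivative (\<lambda>v. (- 1) * (sin (f x) * F' x v))) (at x)" if "x \<in> U" for x
      using F(1) that by (auto intro!: derivative_eq_intros)
    show "Ck_on k U (\<lambda>x. (- 1) * (sin (f x) * F' x v))" for v
      using F(2) * by (intro Ck_on_mult Ck_on_const) auto
  qed
  ultimately show ?case ..
qed

lemma Ck_on_linear_compose:
  assumes "bounded_linear L"
  shows "Ck_on k U f \<Longrightarrow> Ck_on k U (\<lambda>x. L (f x))"
proof (induction k arbitrary: f)
  case 0
  then show ?case
    using assms by (simp add: bounded_linear.continuous_on)
next
  case (Suc k)
  obtain F' where F: "\<forall>x\<in>U. (f has_derivative F' x) (at x)" "\<forall>v. Ck_on k U (\<lambda>x. F' x v)"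
    using Suc.prems by auto
  then show ?case
    using Suc.IH
    by (auto intro!: exI[of _ "\<lambda>x v. L (F' x v)"] bounded_linear.has_derivative[OF assms])
qed

lemma Ck_on_Pair:
  assumes "Ck_on k U f" "Ck_on k U g"
  shows "Ck_on k U (\<lambda>x. (f x, g x))"
proof -
  have L: "bounded_linear (\<lambda>a. (a, 0))" "bounded_linear (\<lambda>b. (0, b))"
    by (auto intro!: bounded_linear_intros)
  show ?thesis
    using Ck_on_add[OF Ck_on_linear_compose[OF L(1) assms(1)] Ck_on_linear_compose[OF L(2) assms(2)]]
    by simp
qed

text \<open>On the standard basis a triple is a sum of scalar multiples of fixed vectors, so
  continuity, \<open>Ck_on\<close> and derivatives follow from those of the entries.\<close>

lemma vector3_expand:
  "(vector [a, b, c] :: real^3) = a *\<^sub>R axis 1 1 + b *\<^sub>R axis 2 1 + c *\<^sub>R axis 3 1"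
  by (simp add: vec_eq_iff forall_3 axis_def)

lemma Ck_on_vector3:
  fixes f g h :: "'a::euclidean_space \<Rightarrow> real"
  assumes "Ck_on k U f" "Ck_on k U g" "Ck_on k U h"
  shows "Ck_on k U (\<lambda>x. vector [f x, g x, h x] :: real^3)"
  unfolding vector3_expand
  by (intro Ck_on_add Ck_on_linear_compose[OF bounded_linear_scaleR_left] assms)

lemma has_derivative_vector3:
  assumes "(f has_derivative f') F" "(g has_derivative g') F" "(h has_derivative h') F"
  shows "((\<lambda>x. vector [f x, g x, h x] :: real^3) has_derivative (\<lambda>v. vector [f' v, g' v, h' v])) F"
  unfolding vector3_expand
  by (intro has_derivative_add has_derivative_scaleR_left assms)

lemma smooth_mapI:
  assumes "\<And>y. q (F y) = f (p y)" "\<And>k. Ck_on k UNIV F"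
  shows "smooth_map p q f"
  unfolding smooth_map_def using assms by (auto intro!: exI[of _ UNIV] exI[of _ F])

lemma smooth_map_continuous:
  assumes "smooth_map p q f" "continuous_on UNIV q"
  shows "continuous_on UNIV (\<lambda>y. f (p y))"
proof -
  have "isCont (\<lambda>y. f (p y)) a" for a
  proof -
    obtain U F where UF: "open U" "a \<in> U" "\<forall>k. Ck_on k U F" "\<forall>y\<in>U. q (F y) = f (p y)"
      using assms(1) unfolding smooth_map_def by meson
    have "continuous_on U F"
      using UF(3)[rule_format, of 0] by simp
    then have "continuous_on U (\<lambda>y. q (F y))"
      by (rule continuous_on_compose2[OF assms(2)]) simp
    then have "continuous_on U (\<lambda>y. f (p y))"
      by (rule continuous_on_eq) (use UF in auto)
    then show ?thesis
      using UF continuous_on_eq_continuous_at by blast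
  qed
  then show ?thesis
    by (simp add: continuous_at_imp_continuous_on)
qed

text \<open>A circle map of degree \<open>a\<close>; integrality of \<open>a\<close> lets the
  formula descend to the quotient. The sine term deforms the map within its homotopy class.\<close>

lift_definition twist :: "int \<Rightarrow> real \<Rightarrow> circle \<Rightarrow> circle" is
  "\<lambda>a c x. of_int a * x + c * sin (2 * pi * x)"
proof -
  fix a c and x y :: real
  assume xy: "x - y \<in> \<int>"
  then have "sin (2 * pi * x) = sin (2 * pi * y)"
    using sin_2pi_abs_circle abs_circle_eq_iff by metis
  moreover have "real_of_int a * (x - y) \<in> \<int>"
    using xy by (intro Ints_mult) auto
  ultimately show "of_int a * x + c * sin (2 * pi * x) - (of_int a * y + c * sin (2 * pi * y)) \<in> \<int>"
    by (simp add: algebra_simps)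
qed

definition coil :: "int \<Rightarrow> real \<Rightarrow> real \<Rightarrow> torus3 \<Rightarrow> phase" where
  "coil a c b \<theta> = ((\<chi> i. if i = 3 then twist a c (\<theta> $ 3) else \<theta> $ i),
     vector [b * cos_2pi (\<theta> $ 3), b * sin_2pi (\<theta> $ 3), 0])"

definition coil_lift :: "int \<Rightarrow> real \<Rightarrow> real \<Rightarrow> real^3 \<Rightarrow> phase_vec" where
  "coil_lift a c b x = (vector [x $ 1, x $ 2, of_int a * x $ 3 + c * sin (2 * pi * x $ 3)],
     vector [b * cos (2 * pi * x $ 3), b * sin (2 * pi * x $ 3), 0])"

definition coil_deriv :: "int \<Rightarrow> real \<Rightarrow> real \<Rightarrow> real \<Rightarrow> real^3 \<Rightarrow> phase_vec" where
  "coil_deriv a c b s u =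
     (vector [u $ 1, u $ 2, (of_int a + 2 * pi * c * cos (2 * pi * s)) * u $ 3],
      vector [- (2 * pi * b * sin (2 * pi * s) * u $ 3), 2 * pi * b * cos (2 * pi * s) * u $ 3, 0])"

lemma phase_cover_coil_lift: "phase_cover (coil_lift a c b x) = coil a c b (torus_cover x)"
  by (simp add: coil_lift_def coil_def vec_eq_iff forall_3 twist.abs_eq)

lemma twist_1_0 [simp]: "twist 1 0 z = z"
  by transfer simp

lemma helix_eq_coil: "helix = coil 1 0 1"
  by (simp add: fun_eq_iff helix_def coil_def vec_eq_iff)

lemma coil_lift_has_derivative:
  assumes "(x has_derivative x') (at t)"
  shows "((\<lambda>t. coil_lift a c b (x t)) has_derivative (\<lambda>h. coil_deriv a c b (x t $ 3) (x' h))) (at t)"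
proof -
  have nth: "((\<lambda>t. x t $ i) has_derivative (\<lambda>h. x' h $ i)) (at t)" for i
    using assms by (rule bounded_linear.has_derivative[OF bounded_linear_vec_nth])
  show ?thesis
    unfolding coil_lift_def coil_deriv_def
    by (intro has_derivative_Pair has_derivative_vector3)
       (auto intro!: derivative_eq_intros nth simp: algebra_simps)
qed

lemma Ck_on_coil_lift:
  assumes "Ck_on k U x" "Ck_on k U c" "Ck_on k U b"
  shows "Ck_on k U (\<lambda>y. coil_lift a (c y) (b y) (x y))"
proof -
  have nth: "Ck_on k U (\<lambda>t. x t $ i)" for i
    using assms(1) by (rule Ck_on_linear_compose[OF bounded_linear_vec_nth])
  have sc: "Ck_on k U (\<lambda>t. sin (2 * pi * x t $ 3))" "Ck_on k U (\<lambda>t. cos (2 * pi * x t $ 3))"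
    using Ck_on_sin_cos[of k U "\<lambda>t. 2 * pi * x t $ 3"] nth
    by (simp_all add: Ck_on_mult Ck_on_const)
  show ?thesis
    unfolding coil_lift_def
    by (intro Ck_on_Pair Ck_on_vector3 Ck_on_mult Ck_on_add Ck_on_const assms sc nth)
qed

lemma smooth_map_coil: "smooth_map torus_cover phase_cover (coil a c b)"
  by (rule smooth_mapI[where F = "coil_lift a c b"], rule phase_cover_coil_lift)
     (intro Ck_on_coil_lift Ck_on_const Ck_on_bounded_linear bounded_linear_ident)

lemma mderiv_coil:
  "mderiv torus_cover phase_cover (coil a c b) (torus_cover x) = coil_deriv a c b (x $ 3)"
proof (rule mderiv_eqI[OF lattice_cover_torus lattice_cover_phase], rule has_mderivI)
  show "phase_cover (coil_lift a c b y) = coil a c b (torus_cover y)" for y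
    by (rule phase_cover_coil_lift)
  show "(coil_lift a c b has_derivative coil_deriv a c b (x $ 3)) (at x)"
    using coil_lift_has_derivative[OF has_derivative_ident] .
qed

lemma continuous_on_twist: "continuous_on UNIV (twist a c)"
  by (rule continuous_on_circleI)
     (auto simp: twist.abs_eq intro!: continuous_intros continuous_on_compose2[OF continuous_on_abs_circle])

lemma continuous_on_coil: "continuous_on UNIV (coil a c b)"
proof -
  have nth: "continuous_on UNIV (\<lambda>\<theta>::torus3. \<theta> $ i)" for i
    by (intro continuous_on_component continuous_on_id)
  have "continuous_on UNIV (\<lambda>\<theta>::torus3. (\<chi> i. if i = 3 then twist a c (\<theta> $ 3) else \<theta> $ i) :: torus3)"
  proof (rule continuous_on_vecI)
    fix i :: 3
    show "continuous_on UNIV (\<lambda>\<theta>::torus3. (\<chi> i. if i = 3 then twist a c (\<theta> $ 3) else \<theta> $ i) $ i)"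
      by (cases "i = 3") (auto intro!: nth continuous_on_compose2[OF continuous_on_twist])
  qed
  moreover have "continuous_on UNIV
      (\<lambda>\<theta>::torus3. vector [b * cos_2pi (\<theta> $ 3), b * sin_2pi (\<theta> $ 3), 0] :: real^3)"
    unfolding vector3_expand
    by (intro continuous_intros continuous_on_compose2[OF continuous_on_cos_2pi]
        continuous_on_compose2[OF continuous_on_sin_2pi] nth) auto
  ultimately show ?thesis
    unfolding coil_def by (rule continuous_on_Pair)
qed

text \<open>If \<open>b\<close> is nonzero, the third angle can be read off from the momentum
  circle. The alternative reads it off from the position and covers the zero section, where an
  isotopy ends with \<open>b = 0\<close>.\<close>

lemma inj_coil:
  assumes "b \<noteq> 0 \<or> a = 1 \<and> c = 0"
  shows "inj (coil a c b)"
proof (rule injI)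
  fix \<theta> \<theta>'
  assume eq: "coil a c b \<theta> = coil a c b \<theta>'"
  then have rest: "\<theta> $ 1 = \<theta>' $ 1" "\<theta> $ 2 = \<theta>' $ 2" and tw: "twist a c (\<theta> $ 3) = twist a c (\<theta>' $ 3)"
    and mom: "b * cos_2pi (\<theta> $ 3) = b * cos_2pi (\<theta>' $ 3)" "b * sin_2pi (\<theta> $ 3) = b * sin_2pi (\<theta>' $ 3)"
    by (auto simp: coil_def vec_eq_iff forall_3)
  have "\<theta> $ 3 = \<theta>' $ 3"
    using assms
  proof
    assume "b \<noteq> 0"
    then show ?thesis using mom by (auto intro: circle_eqI)
  next
    assume "a = 1 \<and> c = 0"
    then show ?thesis using tw by simp
  qed
  with rest show "\<theta> = \<theta>'" by (simp add: vec_eq_iff forall_3)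
qed

lemma inj_coil_deriv:
  assumes "b \<noteq> 0 \<or> a = 1 \<and> c = 0"
  shows "inj (coil_deriv a c b s)"
proof (rule injI)
  fix u v
  assume "coil_deriv a c b s u = coil_deriv a c b s v"
  then have rest: "u $ 1 = v $ 1" "u $ 2 = v $ 2"
    and pos: "(of_int a + 2 * pi * c * cos (2 * pi * s)) * u $ 3 = (of_int a + 2 * pi * c * cos (2 * pi * s)) * v $ 3"
    and mom: "b * (sin (2 * pi * s) * u $ 3) = b * (sin (2 * pi * s) * v $ 3)"
      "b * (cos (2 * pi * s) * u $ 3) = b * (cos (2 * pi * s) * v $ 3)"
    by (auto simp: coil_deriv_def vec_eq_iff forall_3)
  have "u $ 3 = v $ 3"
    using assms
  proof
    assume "b \<noteq> 0"
    moreover have "sin (2 * pi * s) \<noteq> 0 \<or> cos (2 * pi * s) \<noteq> 0"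
      using sin_cos_squared_add[of "2 * pi * s"] by fastforce
    ultimately show ?thesis using mom by auto
  next
    assume "a = 1 \<and> c = 0"
    then show ?thesis using pos by simp
  qed
  with rest show "u = v" by (simp add: vec_eq_iff forall_3)
qed

text \<open>
  Phase space is not an instance of the Hausdorff class, so the inverse of an embedding is
  shown to be continuous after composition with an injection into a Euclidean space.
\<close>

definition phase_embed :: "phase \<Rightarrow> (real^3) \<times> (real^3) \<times> (real^3)" where
  "phase_embed z = ((\<chi> i. cos_2pi (fst z $ i)), (\<chi> i. sin_2pi (fst z $ i)), snd z)"

lemma inj_phase_embed: "inj phase_embed"
  by (rule injI) (auto simp: phase_embed_def vec_eq_iff prod_eq_iff intro: circle_eqI)

lemma continuous_on_phase_embed: "continuous_on UNIV phase_embed"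
  unfolding phase_embed_def
  by (intro continuous_on_Pair continuous_on_vec_lambda continuous_on_snd continuous_on_id
      continuous_on_compose2[OF continuous_on_cos_2pi] continuous_on_compose2[OF continuous_on_sin_2pi]
      continuous_on_component continuous_on_fst) auto

text \<open>The compactness argument is applied to \<open>phase_embed\<close> after
  \<open>k\<close>, a continuous injection into a Euclidean space. Its continuous inverse, preceded
  by \<open>phase_embed\<close>, is \<open>inv k\<close> on the range of \<open>k\<close>.\<close>

lemma torus_homeomorphism:
  fixes k :: "torus3 \<Rightarrow> phase"
  assumes "continuous_on UNIV k" "inj k"
  shows "homeomorphism UNIV (range k) k (inv k)"
proof -
  let ?e = "\<lambda>\<theta>. phase_embed (k \<theta>)"
  have "continuous_on UNIV ?e"
    by (rule continuous_on_compose2[OF continuous_on_phase_embed assms(1)]) simp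
  moreover have "inj ?e"
    using inj_compose[OF inj_phase_embed assms(2)] by (simp add: comp_def)
  ultimately obtain g where g: "homeomorphism UNIV (range ?e) ?e g"
    using homeomorphism_compact[OF compact_torus] by blast
  have "continuous_on (range k) (\<lambda>z. g (phase_embed z))"
    by (rule continuous_on_compose2[OF homeomorphism_cont2[OF g]
          continuous_on_subset[OF continuous_on_phase_embed]]) auto
  then have "continuous_on (range k) (inv k)"
    by (rule continuous_on_eq) (use g assms(2) in \<open>auto simp: homeomorphism_def\<close>)
  then show ?thesis
    unfolding homeomorphism_def using assms by (auto simp: image_image)
qed

lemma torus_embedding_coil:
  assumes "b \<noteq> 0 \<or> a = 1 \<and> c = 0"
  shows "torus_embedding (coil a c b)"
proof -
  have "inj (mderiv torus_cover phase_cover (coil a c b) \<theta>)" for \<theta>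
    by (rule torus_cases[of \<theta>]) (simp add: mderiv_coil inj_coil_deriv[OF assms])
  then show ?thesis
    unfolding torus_embedding_def
    using smooth_map_coil torus_homeomorphism[OF continuous_on_coil inj_coil[OF assms]] by blast
qed

subsection \<open>The free flow\<close>

lift_definition circle_shift :: "real \<Rightarrow> circle \<Rightarrow> circle" is "\<lambda>t x. x + t"
  by simp

definition free_flow :: "real \<Rightarrow> phase \<Rightarrow> phase" where
  "free_flow t z = ((\<chi> i. circle_shift (t * snd z $ i) (fst z $ i)), snd z)"

lemma free_flow_phase_cover:
  "free_flow t (phase_cover y) = phase_cover (fst y + t *\<^sub>R snd y, snd y)"
  by (simp add: free_flow_def vec_eq_iff circle_shift.abs_eq)

lemma circle_shift_0 [simp]: "circle_shift 0 z = z"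
  by transfer simp

lemma circle_shift_shift [simp]: "circle_shift s (circle_shift t z) = circle_shift (s + t) z"
  by transfer (simp add: algebra_simps)

lemma has_derivative_zero_const:
  fixes f :: "real \<Rightarrow> 'b::real_normed_vector"
  assumes "\<And>t. (f has_derivative (\<lambda>h. 0)) (at t)"
  shows "f t = f 0"
proof -
  have "\<exists>c. \<forall>x\<in>UNIV. f x = c"
    by (rule has_derivative_zero_constant) (use assms in auto)
  then show ?thesis by auto
qed

lemma has_derivative_cong_nhds:
  assumes "(f has_derivative G) (at t)" "\<forall>\<^sub>F s in nhds t. f s = g s"
  shows "(g has_derivative G) (at t)"
  using assms(2) has_derivative_transform_eventually[OF assms(1), of g]
  unfolding eventually_nhds_conv_at by simp

lemma mderiv_kinetic:
  "mderiv phase_cover id kinetic z w = (\<Sum>i\<in>UNIV. snd z $ i * snd w $ i)"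
proof -
  obtain y where z: "z = phase_cover y" by (rule phase_cases)
  have nth: "((\<lambda>y::phase_vec. snd y $ i) has_derivative (\<lambda>w. snd w $ i)) (at y)" for i
    by (intro bounded_linear_imp_has_derivative bounded_linear_compose[OF bounded_linear_vec_nth]
        bounded_linear_snd)
  have "has_mderiv phase_cover id kinetic (phase_cover y)
      (\<lambda>w. snd y $ 1 * snd w $ 1 + snd y $ 2 * snd w $ 2 + snd y $ 3 * snd w $ 3)"
  proof (rule has_mderivI)
    show "id (((snd y $ 1)\<^sup>2 + (snd y $ 2)\<^sup>2 + (snd y $ 3)\<^sup>2) / 2) = kinetic (phase_cover y)" for y
      by (simp add: kinetic_def)
    show "((\<lambda>y. ((snd y $ 1)\<^sup>2 + (snd y $ 2)\<^sup>2 + (snd y $ 3)\<^sup>2) / 2) has_derivative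
        (\<lambda>w. snd y $ 1 * snd w $ 1 + snd y $ 2 * snd w $ 2 + snd y $ 3 * snd w $ 3)) (at y)"
      by (auto intro!: derivative_eq_intros nth simp: algebra_simps)
  qed
  then show ?thesis
    by (simp add: mderiv_eqI[OF lattice_cover_phase lattice_cover_id] z sum_3)
qed

lemma omega_alt: "omega X Y = fst X \<bullet> snd Y - snd X \<bullet> fst Y"
  by (simp add: omega_def inner_vec_def sum_subtractf)

lemma omega_nondegenerate:
  assumes "\<And>Y. omega X Y = omega X' Y"
  shows "X = X'"
proof (rule prod_eqI)
  show "fst X = fst X'"
    using assms[of "(0, _)"] by (intro vector_eq_rdot[THEN iffD1]) (simp add: omega_alt)
  show "snd X = snd X'"
    using assms[of "(_, 0)"] by (intro vector_eq_rdot[THEN iffD1]) (simp add: omega_alt)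
qed

lemma mderiv_kinetic_omega: "mderiv phase_cover id kinetic z w = omega (snd z, 0) w"
  by (simp add: mderiv_kinetic omega_def)

text \<open>Nondegeneracy of \<open>omega\<close> pins down the existentially quantified Hamiltonian
  vector: it is the momentum, placed in the angle directions.\<close>

lemma is_hamiltonian_flow_kinetic_iff:
  "is_hamiltonian_flow kinetic \<phi> \<longleftrightarrow>
     (\<forall>x. \<phi> 0 x = x) \<and>
     (\<forall>x t. has_mderiv id phase_cover (\<lambda>s. \<phi> s x) t (\<lambda>h. h *\<^sub>R (snd (\<phi> t x), 0)))"
  unfolding is_hamiltonian_flow_def mderiv_kinetic_omega
  by (metis omega_nondegenerate)

lemma is_hamiltonian_flow_free_flow: "is_hamiltonian_flow kinetic free_flow"
  unfolding is_hamiltonian_flow_kinetic_iff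
proof (intro conjI allI)
  show "free_flow 0 x = x" for x
    by (simp add: free_flow_def prod_eq_iff vec_eq_iff)
  fix x t
  obtain y where x: "x = phase_cover y" by (rule phase_cases)
  have "has_mderiv id phase_cover (\<lambda>s. free_flow s x) (id t) (\<lambda>h. (h *\<^sub>R snd y, 0))"
    by (rule has_mderivI[where F = "\<lambda>s. (fst y + s *\<^sub>R snd y, snd y)"])
       (auto simp: x free_flow_phase_cover intro!: derivative_eq_intros)
  then show "has_mderiv id phase_cover (\<lambda>s. free_flow s x) t (\<lambda>h. h *\<^sub>R (snd (free_flow t x), 0))"
    by (simp add: x free_flow_phase_cover)
qed

text \<open>
  A local representative of an integral curve is only known to be differentiable at a single
  time. Uniqueness is therefore obtained from globally defined functions of the curve whose
  derivative vanishes: the momentum, and the cosine and sine of the angles in a co-moving frame.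
\<close>

lemma hamiltonian_flow_kinetic_unique:
  assumes "is_hamiltonian_flow kinetic \<phi>"
  shows "\<phi> = free_flow"
proof (intro ext)
  fix t x
  let ?c = "\<lambda>s. \<phi> s x"
  have init: "\<phi> 0 x = x"
    using assms unfolding is_hamiltonian_flow_kinetic_iff by blast
  have "\<forall>t. \<exists>F. (\<forall>\<^sub>F s in nhds t. phase_cover (F s) = ?c s) \<and>
      (F has_derivative (\<lambda>h. h *\<^sub>R (snd (?c t), 0))) (at t)"
  proof
    fix t
    have "has_mderiv id phase_cover ?c t (\<lambda>h. h *\<^sub>R (snd (?c t), 0))"
      using assms unfolding is_hamiltonian_flow_kinetic_iff by blast
    then show "\<exists>F. (\<forall>\<^sub>F s in nhds t. phase_cover (F s) = ?c s) \<and>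
        (F has_derivative (\<lambda>h. h *\<^sub>R (snd (?c t), 0))) (at t)"
      unfolding has_mderiv_def by simp
  qed
  from choice[OF this] obtain F where F: "\<forall>t. (\<forall>\<^sub>F s in nhds t. phase_cover (F t s) = ?c s) \<and>
      (F t has_derivative (\<lambda>h. h *\<^sub>R (snd (?c t), 0))) (at t)"
    by (rule exE)
  then have ev: "\<And>t. \<forall>\<^sub>F s in nhds t. phase_cover (F t s) = ?c s"
    and D: "\<And>t. (F t has_derivative (\<lambda>h. h *\<^sub>R (snd (?c t), 0))) (at t)"
    by blast+
  have "((\<lambda>s. snd (?c s)) has_derivative (\<lambda>h. 0)) (at t)" for t
  proof (rule has_derivative_cong_nhds)
    show "((\<lambda>s. snd (F t s)) has_derivative (\<lambda>h. 0)) (at t)"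
      using has_derivative_snd[OF D] by simp
    show "\<forall>\<^sub>F s in nhds t. snd (F t s) = snd (?c s)"
      using ev[of t] by eventually_elim (metis snd_phase_cover)
  qed
  then have "snd (?c t) = snd (?c 0)" for t
    by (rule has_derivative_zero_const)
  then have snd_c: "snd (?c t) = snd x" for t
    by (simp add: init)
  have fst_c: "circle_shift (- t * snd x $ i) (fst (?c t) $ i) = fst x $ i" for t i
  proof -
    let ?d = "\<lambda>s. circle_shift (- s * snd x $ i) (fst (?c s) $ i)"
    have ev': "\<forall>\<^sub>F s in nhds t. ?d s = abs_circle (fst (F t s) $ i - s * snd x $ i)" for t
      using ev[of t]
    proof eventually_elim
      case (elim s)
      then have "fst (?c s) $ i = abs_circle (fst (F t s) $ i)"
        by (metis fst_phase_cover torus_cover_nth)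
      then show ?case by (simp add: circle_shift.abs_eq)
    qed
    have D': "((\<lambda>s. fst (F t s) $ i - s * snd x $ i) has_derivative (\<lambda>h. 0)) (at t)" for t
      using bounded_linear.has_derivative[OF bounded_linear_vec_nth[of i] has_derivative_fst[OF D]]
      by (auto intro!: derivative_eq_intros simp: snd_c)
    have "((\<lambda>s. cos_2pi (?d s)) has_derivative (\<lambda>h. 0)) (at t)" for t
    proof (rule has_derivative_cong_nhds)
      show "((\<lambda>s. cos (2 * pi * (fst (F t s) $ i - s * snd x $ i))) has_derivative (\<lambda>h. 0)) (at t)"
        by (rule derivative_eq_intros D' refl)+ auto
      show "\<forall>\<^sub>F s in nhds t. cos (2 * pi * (fst (F t s) $ i - s * snd x $ i)) = cos_2pi (?d s)"
        using ev'[of t] by eventually_elim simp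
    qed
    then have "cos_2pi (?d t) = cos_2pi (?d 0)" by (rule has_derivative_zero_const)
    moreover have "((\<lambda>s. sin_2pi (?d s)) has_derivative (\<lambda>h. 0)) (at t)" for t
    proof (rule has_derivative_cong_nhds)
      show "((\<lambda>s. sin (2 * pi * (fst (F t s) $ i - s * snd x $ i))) has_derivative (\<lambda>h. 0)) (at t)"
        by (rule derivative_eq_intros D' refl)+ auto
      show "\<forall>\<^sub>F s in nhds t. sin (2 * pi * (fst (F t s) $ i - s * snd x $ i)) = sin_2pi (?d s)"
        using ev'[of t] by eventually_elim simp
    qed
    then have "sin_2pi (?d t) = sin_2pi (?d 0)" by (rule has_derivative_zero_const)
    ultimately have "?d t = ?d 0" by (rule circle_eqI)
    then show ?thesis
      by (simp add: init)
  qed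
  have "fst (?c t) $ i = circle_shift (t * snd x $ i) (fst x $ i)" for i
    using fst_c[of t i, symmetric] by simp
  then show "\<phi> t x = free_flow t x"
    by (simp add: free_flow_def prod_eq_iff vec_eq_iff snd_c)
qed

lemma hamiltonian_flow_kinetic: "hamiltonian_flow kinetic = free_flow"
  unfolding hamiltonian_flow_def
  using is_hamiltonian_flow_free_flow hamiltonian_flow_kinetic_unique by (rule the_equality)

lemma mderiv_free_flow:
  "mderiv phase_cover phase_cover (free_flow t) z v = (fst v + t *\<^sub>R snd v, snd v)"
proof -
  obtain y where z: "z = phase_cover y" by (rule phase_cases)
  have "has_mderiv phase_cover phase_cover (free_flow t) (phase_cover y)
      (\<lambda>v. (fst v + t *\<^sub>R snd v, snd v))"
    by (rule has_mderivI[where F = "\<lambda>y. (fst y + t *\<^sub>R snd y, snd y)"])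
       (auto simp: free_flow_phase_cover intro!: bounded_linear_imp_has_derivative bounded_linear_intros)
  then show ?thesis
    by (simp add: z mderiv_eqI[OF lattice_cover_phase lattice_cover_phase])
qed

lemma vertical_eq: "vertical z = {0} \<times> UNIV"
proof -
  obtain y where z: "z = phase_cover y" by (rule phase_cases)
  have "has_mderiv phase_cover torus_cover fst (phase_cover y) fst"
    by (rule has_mderivI[where F = fst])
       (auto intro: bounded_linear_imp_has_derivative bounded_linear_fst)
  then show ?thesis
    by (auto simp: vertical_def z mderiv_eqI[OF lattice_cover_phase lattice_cover_torus])
qed

text \<open>At time t a vertical vector (0, v) becomes (t v, v), which for nonzero t is vertical
  only if v = 0.\<close>

lemma no_conjugate_points_free_flow: "no_conjugate_points free_flow S"
  unfolding no_conjugate_points_def vertical_eq mderiv_free_flow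
  by (auto simp: image_iff zero_prod_def)

lemma flow_invariant_coil: "flow_invariant free_flow (range (coil a c b))"
proof -
  have sub: "free_flow t ` range (coil a c b) \<subseteq> range (coil a c b)" for t
  proof (rule image_subsetI, erule rangeE, hypsubst)
    fix \<theta>
    let ?\<theta>' = "\<chi> i. circle_shift (t * snd (coil a c b \<theta>) $ i) (\<theta> $ i)"
    have "free_flow t (coil a c b \<theta>) = coil a c b ?\<theta>'"
      by (simp add: free_flow_def coil_def vec_eq_iff forall_3)
    then show "free_flow t (coil a c b \<theta>) \<in> range (coil a c b)" by simp
  qed
  have inv: "free_flow t (free_flow (- t) z) = z" for t z
    by (simp add: free_flow_def prod_eq_iff vec_eq_iff)
  have "range (coil a c b) \<subseteq> free_flow t ` range (coil a c b)" for t
  proof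
    fix z assume "z \<in> range (coil a c b)"
    then have "free_flow (- t) z \<in> range (coil a c b)" using sub by blast
    then show "z \<in> free_flow t ` range (coil a c b)" using inv by (metis imageI)
  qed
  with sub show ?thesis
    unfolding flow_invariant_def by blast
qed

text \<open>The image of a straight line of the cover is a smooth curve in the torus with the
  required velocity. Exhibiting such vectors is what refutes isotropy.\<close>

lemma tangent_space_coil:
  "coil_deriv a c b (x $ 3) u \<in> tangent_space (range (coil a c b)) (coil a c b (torus_cover x))"
proof -
  let ?c = "\<lambda>t. coil a c b (torus_cover (x + t *\<^sub>R u))"
  have D: "((\<lambda>t. coil_lift a c b (x + t *\<^sub>R u)) has_derivative
      (\<lambda>h. coil_deriv a c b ((x + 0 *\<^sub>R u) $ 3) (h *\<^sub>R u))) (at 0)"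
    by (rule coil_lift_has_derivative) (auto intro!: derivative_eq_intros)
  have "has_mderiv id phase_cover ?c (id 0) (\<lambda>h. coil_deriv a c b ((x + 0 *\<^sub>R u) $ 3) (h *\<^sub>R u))"
    by (rule has_mderivI[OF _ D]) (simp add: phase_cover_coil_lift)
  then have "mderiv id phase_cover ?c 0 = (\<lambda>h. coil_deriv a c b ((x + 0 *\<^sub>R u) $ 3) (h *\<^sub>R u))"
    by (intro mderiv_eqI[OF lattice_cover_id lattice_cover_phase]) simp
  then have "velocity ?c 0 = coil_deriv a c b (x $ 3) u"
    by (simp add: velocity_def)
  moreover have "smooth_map id phase_cover ?c"
  proof (rule smooth_mapI)
    show "phase_cover (coil_lift a c b (x + t *\<^sub>R u)) = ?c (id t)" for t
      by (simp add: phase_cover_coil_lift)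
    show "Ck_on k UNIV (\<lambda>t. coil_lift a c b (x + t *\<^sub>R u))" for k
      by (intro Ck_on_coil_lift Ck_on_add Ck_on_const Ck_on_bounded_linear bounded_linear_scaleR_left)
  qed
  ultimately show ?thesis
    unfolding tangent_space_def by (intro CollectI exI[of _ ?c]) auto
qed

lemma coil_not_lagrangian:
  assumes "b \<noteq> 0"
  shows "\<not> lagrangian (range (coil a c b))"
proof
  assume L: "lagrangian (range (coil a c b))"
  \<comment> \<open>At third angle 1/4 the momentum circle moves in the direction of
    \<open>r_1\<close>, so the third tangent direction pairs nontrivially with the first
    angle.\<close>
  let ?x = "axis 3 (1/4) :: real^3"
  let ?X = "coil_deriv a c b (?x $ 3) (axis 1 1)" and ?Y = "coil_deriv a c b (?x $ 3) (axis 3 1)"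
  have "omega ?X ?Y = 0"
    using L tangent_space_coil[of a c b ?x] unfolding lagrangian_def by blast
  moreover have "omega ?X ?Y = - (2 * pi * b)"
    by (simp add: omega_def coil_deriv_def sum_3 axis_def)
  ultimately show False using assms by simp
qed

subsection \<open>Lifts, isotopies and graphs\<close>

text \<open>A nonvanishing complex function on a contractible space has a continuous logarithm. The
  modulus is 1 here, so the imaginary part divided by 2 pi is an angle.\<close>

lemma circle_lift:
  fixes f :: "'a::real_normed_vector \<Rightarrow> circle"
  assumes "continuous_on UNIV f"
  obtains h where "continuous_on UNIV h" "\<And>x. abs_circle (h x) = f x"
proof -
  let ?z = "\<lambda>x. Complex (cos_2pi (f x)) (sin_2pi (f x))"
  have sq: "(cos_2pi z)\<^sup>2 + (sin_2pi z)\<^sup>2 = 1" for z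
    by (rule circle_cases[of z]) simp
  have "continuous_on UNIV ?z"
    unfolding Complex_eq
    by (intro continuous_intros continuous_on_compose2[OF continuous_on_cos_2pi assms]
        continuous_on_compose2[OF continuous_on_sin_2pi assms]) auto
  moreover have "?z x \<noteq> 0" for x
    using sq[of "f x"] by (auto simp: complex_eq_iff)
  ultimately obtain g where g: "continuous_on UNIV g" "\<And>x. ?z x = exp (g x)"
    using continuous_logarithm_on_contractible[of UNIV ?z] by auto
  let ?h = "\<lambda>x. Im (g x) / (2 * pi)"
  have "abs_circle (?h x) = f x" for x
  proof -
    have "norm (?z x) = 1"
      using sq[of "f x"] by (simp add: cmod_def)
    then have "exp (Re (g x)) = 1"
      by (simp add: g(2))
    then have "cos_2pi (f x) = cos (Im (g x))" "sin_2pi (f x) = sin (Im (g x))"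
      using g(2)[of x] by (simp_all add: complex_eq_iff Re_exp Im_exp)
    then show ?thesis
      by (intro circle_eqI) auto
  qed
  moreover have "continuous_on UNIV ?h"
    using g(1) by (intro continuous_intros) auto
  ultimately show ?thesis by (rule that[rotated])
qed

lemma torus_lift:
  fixes f :: "'a::real_normed_vector \<Rightarrow> torus3"
  assumes "continuous_on UNIV f"
  obtains h where "continuous_on UNIV h" "\<And>x. torus_cover (h x) = f x"
proof -
  have "\<forall>i. \<exists>h. continuous_on UNIV h \<and> (\<forall>x. abs_circle (h x) = f x $ i)"
    using circle_lift[OF continuous_on_component[OF assms]] by metis
  then obtain h where "\<And>i. continuous_on UNIV (h i)" "\<And>i x. abs_circle (h i x) = f x $ i"
    by metis
  then show ?thesis
    by (intro that[of "\<lambda>x. \<chi> i. h i x"] continuous_on_vec_lambda) (auto simp: vec_eq_iff)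
qed

lemma continuous_Ints_constant:
  fixes f :: "'a::real_normed_vector \<Rightarrow> real"
  assumes "continuous_on UNIV f" "\<And>x. f x \<in> \<int>"
  shows "f x = f y"
proof -
  have "\<exists>e>0. \<forall>y. y \<in> UNIV \<and> f y \<noteq> f x \<longrightarrow> e \<le> norm (f y - f x)" for x
    using Ints_small_eq_0[OF Ints_diff[OF assms(2) assms(2)]]
    by (intro exI[of _ 1]) (auto simp: not_less[symmetric])
  then have "f constant_on UNIV"
    using continuous_discrete_range_constant[OF connected_UNIV assms(1)] by blast
  then show ?thesis
    by (auto simp: constant_on_def)
qed

text \<open>The difference of two lifts is continuous and integer-valued on a connected space. All
  monodromy computations below reduce to this.\<close>

lemma continuous_circle_lifts_constant:
  fixes f g :: "'a::real_normed_vector \<Rightarrow> real"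
  assumes "continuous_on UNIV f" "continuous_on UNIV g" "\<And>x. abs_circle (f x) = abs_circle (g x)"
  shows "f x - g x = f y - g y"
  using assms by (intro continuous_Ints_constant[of "\<lambda>x. f x - g x"] continuous_intros)
    (auto simp: abs_circle_eq_iff)

lemma continuous_torus_lifts_constant:
  fixes f g :: "'a::real_normed_vector \<Rightarrow> real^3"
  assumes "continuous_on UNIV f" "continuous_on UNIV g" "\<And>x. torus_cover (f x) = torus_cover (g x)"
  shows "f x - g x = f y - g y"
proof -
  have "f x $ i - g x $ i = f y $ i - g y $ i" for i
    using assms
    by (intro continuous_circle_lifts_constant continuous_on_component) (auto simp: vec_eq_iff)
  then show ?thesis by (simp add: vec_eq_iff)
qed

lemma range_coil_zero: "range (coil 1 0 0) = zero_section"
  by (auto simp: coil_def zero_section_def image_iff vec_eq_iff forall_3)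

text \<open>The fold and the momentum radius shrink together. Before time 1 the nonzero radius gives
  an embedding; at time 1 both parameters vanish and the zero section itself remains.\<close>

lemma isotopic_coil_zero_section: "isotopic_tori (range (coil 1 c b)) zero_section"
  if "b \<noteq> 0"
  unfolding isotopic_tori_def
proof (intro exI[of _ "\<lambda>s. coil 1 ((1 - s) * c) ((1 - s) * b)"] conjI ballI)
  show "smooth_map (map_prod id torus_cover) phase_cover
      (\<lambda>(s, \<theta>). coil 1 ((1 - s) * c) ((1 - s) * b) \<theta>)"
  proof (rule smooth_mapI)
    show "phase_cover (coil_lift 1 ((1 - fst y) * c) ((1 - fst y) * b) (snd y)) =
        (case map_prod id torus_cover y of (s, \<theta>) \<Rightarrow> coil 1 ((1 - s) * c) ((1 - s) * b) \<theta>)" for y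
      by (simp add: phase_cover_coil_lift case_prod_beta)
    have "Ck_on k UNIV (\<lambda>y::real \<times> (real^3). 1 + (- 1) * fst y)" for k
      by (intro Ck_on_add Ck_on_mult Ck_on_const Ck_on_bounded_linear bounded_linear_fst)
    then have "Ck_on k UNIV (\<lambda>y::real \<times> (real^3). 1 - fst y)" for k
      by simp
    then show "Ck_on k UNIV (\<lambda>y. coil_lift 1 ((1 - fst y) * c) ((1 - fst y) * b) (snd y))" for k
      by (intro Ck_on_coil_lift Ck_on_mult) (auto intro: Ck_on_bounded_linear bounded_linear_snd)
  qed
  show "torus_embedding (coil 1 ((1 - s) * c) ((1 - s) * b))" for s
    by (rule torus_embedding_coil) (use that in auto)
qed (auto simp: range_coil_zero)

text \<open>
  Along an isotopy to the zero section, the third angle would remain null-homotopic, whereas on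
  the zero section it generates a nontrivial covering of the circle.
\<close>

lemma coil_0_not_isotopic_zero_section: "\<not> isotopic_tori (range (coil 0 0 b)) zero_section"
proof
  assume "isotopic_tori (range (coil 0 0 b)) zero_section"
  then obtain F where sm: "smooth_map (map_prod id torus_cover) phase_cover (\<lambda>(s, \<theta>). F s \<theta>)"
    and emb: "\<And>s. s \<in> {0..1} \<Longrightarrow> torus_embedding (F s)"
    and F0: "range (F 0) = range (coil 0 0 b)" and F1: "range (F (1::real)) = zero_section"
    unfolding isotopic_tori_def by blast
  have "continuous_on UNIV (\<lambda>y. (\<lambda>(s, \<theta>). F s \<theta>) (map_prod id torus_cover y))"
    by (rule smooth_map_continuous[OF sm continuous_on_phase_cover])
  then have contF: "continuous_on UNIV (\<lambda>y. F (fst y) (torus_cover (snd y)))"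
    by (simp add: case_prod_beta)
  obtain h where h: "continuous_on UNIV h"
    "\<And>y. abs_circle (h y) = fst (F (fst y) (torus_cover (snd y))) $ 3"
    using circle_lift[OF continuous_on_component[OF continuous_on_fst[OF contF]]] by metis
  \<comment> \<open>The jump of \<open>h\<close> under a period is an integer depending continuously
    on time and position, hence one constant. It vanishes at time 0, where \<open>h\<close> lifts a
    constant angle.\<close>
  have h_periodic: "h (1, x) = h (1, x')" if eq: "torus_cover x = torus_cover x'" for x x'
  proof -
    have tr: "torus_cover (y + (x' - x)) = torus_cover y" for y
      by (rule torus_cover_translate[OF eq])
    have cont: "continuous_on UNIV (\<lambda>y. h (fst y, snd y + (x' - x)))"
      by (intro continuous_on_compose2[OF h(1)] continuous_intros) auto
    have const: "h (fst y, snd y + (x' - x)) - h y = h (fst z, snd z + (x' - x)) - h z" for y z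
      by (rule continuous_circle_lifts_constant[OF cont h(1)]) (simp add: h(2) tr)
    have "fst (F 0 \<theta>) $ 3 = abs_circle 0" for \<theta>
    proof -
      have "F 0 \<theta> \<in> range (coil 0 0 b)" using F0 by blast
      then show ?thesis
        by (elim rangeE, rule_tac \<theta> = x in torus_cases) (simp add: coil_def twist.abs_eq)
    qed
    then have "h (0, x) - 0 = h (0, x') - 0"
      by (intro continuous_circle_lifts_constant[of "\<lambda>x. h (0, x)" "\<lambda>_. 0"]
          continuous_on_compose2[OF h(1)] continuous_intros) (auto simp: h(2))
    then show ?thesis
      using const[of "(0, x)" "(1, x)"] by simp
  qed
  have hom: "homeomorphism UNIV (range (F 1)) (F 1) (inv (F 1))"
    using emb[of 1] by (simp add: torus_embedding_def)
  \<comment> \<open>Through the inverse of \<open>F 1\<close>, the third angle on the zero section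
    is lifted by \<open>h (1, k x)\<close>, which differs from \<open>x $ 3\<close> by a constant
    and so grows by 1 over one period. Yet \<open>k\<close> sends the ends of that period to points
    over the same torus point, where \<open>h\<close> has equal values.\<close>
  have "continuous_on UNIV (\<lambda>x. inv (F 1) (torus_cover x, 0))"
    by (rule continuous_on_compose2[OF homeomorphism_cont2[OF hom]])
       (auto simp: F1 zero_section_def intro!: continuous_on_Pair continuous_on_torus_cover continuous_on_const)
  then obtain k where k: "continuous_on UNIV k" "\<And>x. torus_cover (k x) = inv (F 1) (torus_cover x, 0)"
    by (rule torus_lift) blast
  have "F 1 (torus_cover (k x)) = (torus_cover x, 0)" for x
    using homeomorphism_apply2[OF hom, of "(torus_cover x, 0)"] by (simp add: k(2) F1 zero_section_def)
  then have "h (1, k x) - x $ 3 = h (1, k y) - y $ 3" for x y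
    by (intro continuous_circle_lifts_constant[of "\<lambda>x. h (1, k x)" "\<lambda>x. x $ 3"]
        continuous_on_compose2[OF h(1)] continuous_intros k(1) continuous_on_component)
       (auto simp: h(2))
  from this[of "axis 3 1" 0] have "h (1, k (axis 3 1)) = h (1, k 0) + 1"
    by simp
  moreover have "torus_cover (axis 3 1) = torus_cover 0"
    by (auto simp: torus_cover_eq_iff axis_def)
  then have "h (1, k (axis 3 1)) = h (1, k 0)"
    by (intro h_periodic) (simp add: k(2))
  ultimately show False by simp
qed

lemma not_graph:
  assumes "fst (k x) = fst (k y)" "k x \<noteq> k y"
  shows "\<not> is_graph (range k)"
  using assms unfolding is_graph_def by (metis rangeI rangeE)

lemma coil_0_not_graph:
  assumes "b \<noteq> 0"
  shows "\<not> is_graph (range (coil 0 0 b))"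
proof (rule not_graph)
  let ?x = "torus_cover 0" and ?y = "torus_cover (axis 3 (1/4))"
  show "fst (coil 0 0 b ?x) = fst (coil 0 0 b ?y)"
    by (simp add: coil_def vec_eq_iff forall_3 twist.abs_eq axis_def)
  show "coil 0 0 b ?x \<noteq> coil 0 0 b ?y"
    using assms by (simp add: coil_def vec_eq_iff forall_3 axis_def)
qed

text \<open>The function s + sin(2 pi s)/4 takes the value 1/2 both at s = 1/4 and at s = 3/4, where
  the momenta are opposite.\<close>

lemma coil_quarter_not_graph:
  assumes "b \<noteq> 0"
  shows "\<not> is_graph (range (coil 1 (1/4) b))"
proof (rule not_graph)
  have sin34: "sin (2 * pi * (3 / 4)) = - 1"
    using sin_3over2_pi by (simp add: field_simps)
  let ?x = "torus_cover (axis 3 (1/4))" and ?y = "torus_cover (axis 3 (3/4))"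
  show "fst (coil 1 (1/4) b ?x) = fst (coil 1 (1/4) b ?y)"
    using sin34 by (simp add: coil_def vec_eq_iff forall_3 twist.abs_eq axis_def)
  show "coil 1 (1/4) b ?x \<noteq> coil 1 (1/4) b ?y"
    using assms sin34 by (simp add: coil_def vec_eq_iff forall_3 axis_def)
qed

subsection \<open>Symplectic maps preserving the torus\<close>

text \<open>Equality of directions, expressed by a vanishing determinant. The zero vector is
  parallel to everything, hence the nonvanishing conditions in what follows.\<close>

definition parallel :: "real \<times> real \<Rightarrow> real \<times> real \<Rightarrow> bool" where
  "parallel u v \<longleftrightarrow> fst u * snd v = snd u * fst v"

text \<open>The columns of the matrix are (a, b) and (c, d), matching the lattice increments of a
  lift.\<close>

definition lin2 :: "int \<Rightarrow> int \<Rightarrow> int \<Rightarrow> int \<Rightarrow> real \<times> real \<Rightarrow> real \<times> real" where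
  "lin2 a b c d w = (a * fst w + c * snd w, b * fst w + d * snd w)"

lemma parallel_sym: "parallel u v \<Longrightarrow> parallel v u"
  by (simp add: parallel_def mult.commute)

lemma parallel_trans:
  assumes "parallel v u" "parallel v w" "v \<noteq> 0"
  shows "parallel u w"
proof -
  obtain p q where v: "v = (p, q)" by (cases v)
  have 1: "p * snd u = q * fst u" "p * snd w = q * fst w"
    using assms by (auto simp: parallel_def v)
  have "p * (fst u * snd w - snd u * fst w) = fst u * (p * snd w) - (p * snd u) * fst w"
    by (simp add: algebra_simps)
  also have "\<dots> = 0" by (simp add: 1)
  finally have p: "p * (fst u * snd w - snd u * fst w) = 0" .
  have "q * (fst u * snd w - snd u * fst w) = (q * fst u) * snd w - snd u * (q * fst w)"
    by (simp add: algebra_simps)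
  also have "\<dots> = 0" by (simp add: 1[symmetric])
  finally have "q * (fst u * snd w - snd u * fst w) = 0" .
  with p assms(3) show ?thesis
    by (auto simp: v parallel_def zero_prod_def)
qed

lemma parallel_lin2:
  assumes "a * d - b * c \<noteq> 0"
  shows "parallel (lin2 a b c d u) (lin2 a b c d v) \<longleftrightarrow> parallel u v"
proof -
  have "fst (lin2 a b c d u) * snd (lin2 a b c d v) - snd (lin2 a b c d u) * fst (lin2 a b c d v)
      = real_of_int (a * d - b * c) * (fst u * snd v - snd u * fst v)"
    by (simp add: lin2_def algebra_simps)
  then show ?thesis
    using assms unfolding parallel_def by (metis eq_iff_diff_eq_0 mult_eq_0_iff of_int_eq_0_iff)
qed

lemma lin2_nonzero:
  assumes "a * d - b * c \<noteq> 0" "w \<noteq> 0"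
  shows "lin2 a b c d w \<noteq> 0"
proof
  assume "lin2 a b c d w = 0"
  then have "parallel (lin2 a b c d w) (lin2 a b c d v)" for v
    by (simp add: parallel_def)
  then have "parallel w v" for v
    using parallel_lin2[OF assms(1)] by blast
  from this[of "(0, 1)"] this[of "(1, 0)"] show False
    using assms(2) by (simp add: parallel_def prod_eq_iff)
qed

text \<open>
  The characteristic polynomial has a real root, unless the determinant is 1 and the trace is
  0, 1 or -1. In the latter cases the square or the cube of the matrix is scalar.
\<close>

lemma finite_invariant_directions:
  fixes a b c d :: int
  assumes det: "\<bar>a * d - b * c\<bar> = 1"
  obtains W where "finite W" "W \<noteq> {}" "0 \<notin> W"
    "\<And>w. w \<in> W \<Longrightarrow> \<exists>w'\<in>W. parallel (lin2 a b c d w) w'"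
    "\<And>w. w \<in> W \<Longrightarrow> \<exists>w'\<in>W. parallel (lin2 a b c d w') w"
proof (cases "(a + d)\<^sup>2 \<ge> 4 * (a * d - b * c)")
  case True
  define D where "D = real_of_int ((a + d)\<^sup>2 - 4 * (a * d - b * c))"
  define l where "l = (of_int (a + d) + sqrt D) / 2"
  have "sqrt D * sqrt D = D"
    using True by (simp add: D_def del: of_int_diff of_int_power)
  moreover have "sqrt D = 2 * l - of_int (a + d)"
    by (simp add: l_def field_simps)
  ultimately have "(2 * l - of_int (a + d)) * (2 * l - of_int (a + d)) = D"
    by simp
  then have l: "l * l = of_int a * l + of_int d * l - of_int a * of_int d + of_int b * of_int c"
    by (simp add: D_def power2_eq_square algebra_simps)
  \<comment> \<open>Each of (c, l - a) and (l - d, b) is annihilated by one row of the matrix minus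
    l, and by the other row because l is an eigenvalue. If both vanish, the matrix is scalar and any
    vector serves.\<close>
  obtain w where w: "w \<noteq> 0" "parallel (lin2 a b c d w) w"
  proof (cases "(of_int c, l - of_int a) = (0 :: real \<times> real)")
    case False
    have "of_int b * of_int c + of_int d * (l - of_int a) = l * (l - of_int a)"
      "of_int a * of_int c + of_int c * (l - of_int a) = l * of_int c"
      using l by (simp_all add: algebra_simps)
    then have "lin2 a b c d (of_int c, l - of_int a) = (l * of_int c, l * (l - of_int a))"
      by (simp add: lin2_def)
    then show ?thesis
      using False by (intro that[of "(of_int c, l - of_int a)"]) (simp_all add: parallel_def)
  next
    case True
    show ?thesis
    proof (cases "(l - of_int d, of_int b) = (0 :: real \<times> real)")
      case False
      have "of_int a * (l - of_int d) + of_int c * of_int b = l * (l - of_int d)"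
        "of_int b * (l - of_int d) + of_int d * of_int b = l * of_int b"
        using l by (simp_all add: algebra_simps)
      then have "lin2 a b c d (l - of_int d, of_int b) = (l * (l - of_int d), l * of_int b)"
        by (simp add: lin2_def)
      then show ?thesis
        using False by (intro that[of "(l - of_int d, of_int b)"]) (simp_all add: parallel_def)
    next
      case True
      then show ?thesis
        by (intro that[of "(1, 0)"]) (auto simp: parallel_def lin2_def zero_prod_def)
    qed
  qed
  then show ?thesis
    by (intro that[of "{w}"]) auto
next
  case False
  then have "a * d - b * c > 0"
    by (smt (verit) zero_le_power2)
  then have det1: "a * d - b * c = 1"
    using det by linarith
  then have "(a + d)\<^sup>2 < 2\<^sup>2"
    using False by simp
  then have "\<bar>a + d\<bar> < 2"
    using power2_less_imp_less[of "\<bar>a + d\<bar>" 2] by simp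
  then consider (0) "a + d = 0" | (1) "(a + d) * (a + d) = 1"
    by (smt (verit) mult_cancel_left1 mult_minus_left mult_minus_right)
  then show ?thesis
  proof cases
    case 0
    then have d: "d = - a" by simp
    \<comment> \<open>With trace 0 and determinant 1 the square is -1, so the matrix exchanges the
      directions of (1, 0) and of its image (a, b).\<close>
    have "(of_int a, of_int b) \<noteq> (0 :: real \<times> real)"
      using det1 by (auto simp: zero_prod_def)
    then show ?thesis
      by (intro that[of "{(1, 0), (of_int a, of_int b)}"])
         (auto simp: parallel_def lin2_def zero_prod_def d algebra_simps)
  next
    case 1
    define t where "t = a + d"
    have d: "d = t - a" and t: "t * t = 1" using 1 by (auto simp: t_def)
    have bc: "b * c = a * t - a * a - 1" using det1 by (simp add: d algebra_simps)
    \<comment> \<open>Write A for the matrix. By Cayley-Hamilton A^2 = t A - 1, so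
      \<open>?w\<close>, which is t times \<open>?v\<close> minus \<open>?u\<close>, is the image of
      \<open>?v\<close>; and A^3 = -t since t^2 = 1, so the three directions form a cycle. If
      \<open>b\<close> were 0, the diagonal entries would be integers with product 1, hence equal,
      and their sum could not be 1 or -1.\<close>
    let ?u = "(1, 0) :: real \<times> real" and ?v = "(of_int a, of_int b) :: real \<times> real"
    let ?w = "(of_int (t * a - 1), of_int (t * b)) :: real \<times> real"
    have "b \<noteq> 0"
    proof
      assume "b = 0"
      then have "a * t - a * a = 1" using bc by simp
      then have "a * (t - a) = 1" by (simp add: algebra_simps)
      then have "a = t - a \<and> \<bar>a\<bar> = 1"
        using zmult_eq_1_iff by auto
      then have "\<bar>t\<bar> = 2" by auto
      moreover have "t = 1 \<or> t = - 1" using t zmult_eq_1_iff by auto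
      ultimately show False by auto
    qed
    have u: "lin2 a b c d ?u = ?v"
      by (simp add: lin2_def)
    have "lin2 a b c d ?v = ?w"
    proof -
      have "of_int a * of_int a + of_int c * of_int b = (of_int (a * a + b * c) :: real)"
        by simp
      also have "a * a + b * c = t * a - 1" by (simp add: bc)
      finally show ?thesis by (simp add: lin2_def d algebra_simps)
    qed
    moreover have "parallel (lin2 a b c d ?w) ?u"
    proof -
      have "snd (lin2 a b c d ?w) = of_int (b * (t * t - 1))"
        by (simp add: lin2_def d algebra_simps)
      then show ?thesis by (simp add: t parallel_def)
    qed
    moreover have "?u \<noteq> 0" "?v \<noteq> 0" "?w \<noteq> 0"
      using \<open>b \<noteq> 0\<close> t by (auto simp: zero_prod_def)
    moreover have "parallel x x" for x
      by (simp add: parallel_def)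
    ultimately show ?thesis
      using u by (intro that[of "{?u, ?v, ?w}"]) (simp_all, metis+)
  qed
qed

section \<open>The differential of a lift and the kernel of the restricted form\<close>

lemma phase_cover_helix: "phase_cover (coil_lift 1 0 1 x) = helix (torus_cover x)"
  by (simp add: phase_cover_coil_lift helix_eq_coil)

lemma fst_coil_lift: "fst (coil_lift 1 0 1 x) = x"
  by (simp add: coil_lift_def vec_eq_iff forall_3)

lemma fst_helix [simp]: "fst (helix \<theta>) = \<theta>"
  by (simp add: helix_def)

definition heading :: "real \<Rightarrow> real^3" where
  "heading s = vector [cos (2 * pi * s), sin (2 * pi * s), 0]"

text \<open>The restricted form is 2 pi times the wedge of the 1-form u_2 cos - u_1 sin with d
  theta_3. Its kernel is the common kernel of these two 1-forms, the line of
  \<open>heading s\<close>.\<close>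

lemma omega_coil_deriv:
  "omega (coil_deriv 1 0 1 s u) (coil_deriv 1 0 1 s v) =
     2 * pi * ((u $ 2 * cos (2 * pi * s) - u $ 1 * sin (2 * pi * s)) * v $ 3
       - u $ 3 * (v $ 2 * cos (2 * pi * s) - v $ 1 * sin (2 * pi * s)))"
  by (simp add: omega_def coil_deriv_def sum_3 algebra_simps)

text \<open>
  The kernel of the symplectic form restricted to the torus is spanned by the heading, so it
  is preserved by the differential of a symplectic map that preserves the torus.
\<close>

lemma symplectic_lift_preserves_heading:
  assumes f: "symplectic_diffeo f"
    and G: "continuous_on UNIV G" "\<And>x. helix (torus_cover (G x)) = f (helix (torus_cover x))"
  obtains G' where "(G has_derivative G') (at x)" "G' (heading (x $ 3)) $ 3 = 0"
    "G' (heading (x $ 3)) $ 2 * cos (2 * pi * G x $ 3) = G' (heading (x $ 3)) $ 1 * sin (2 * pi * G x $ 3)"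
proof -
  let ?h = "coil_lift 1 0 1" and ?h' = "coil_deriv 1 0 1"
  have Dh: "(?h has_derivative ?h' (y $ 3)) (at y)" for y
    using coil_lift_has_derivative[OF has_derivative_ident] .
  obtain U F where UF: "open U" "?h x \<in> U" "\<forall>k. Ck_on k U F" "\<forall>y\<in>U. phase_cover (F y) = f (phase_cover y)"
    using f unfolding symplectic_diffeo_def smooth_map_def by meson
  obtain B where B: "(F has_derivative B) (at (?h x))"
    using UF(2) UF(3)[rule_format, of 1] by auto
  have evU: "\<forall>\<^sub>F y in nhds (?h x). phase_cover (F y) = f (phase_cover y)"
    using UF(1,2,4) eventually_nhds by blast
  then have "has_mderiv phase_cover phase_cover f (phase_cover (?h x)) B"
    unfolding has_mderiv_def using B by blast
  then have "mderiv phase_cover phase_cover f (phase_cover (?h x)) = B"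
    by (rule mderiv_eqI[OF lattice_cover_phase lattice_cover_phase])
  then have sympl: "omega (B X) (B Y) = omega X Y" for X Y
    using f unfolding symplectic_diffeo_def by metis
  have DFh: "((\<lambda>y. F (?h y)) has_derivative (\<lambda>u. B (?h' (x $ 3) u))) (at x)"
    by (rule has_derivative_compose[OF Dh B])
  have contG: "isCont G x"
    using G(1) by (simp add: continuous_on_eq_continuous_at)
  have contGh: "isCont (\<lambda>y. ?h (G y)) x"
    by (rule isCont_o2[OF contG has_derivative_continuous[OF Dh]])
  have "filterlim ?h (nhds (?h x)) (nhds x)"
    using has_derivative_continuous[OF Dh, of x] by (simp add: continuous_at tendsto_at_iff_tendsto_nhds)
  then have "\<forall>\<^sub>F y in nhds x. phase_cover (F (?h y)) = f (phase_cover (?h y))"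
    using evU by (rule eventually_compose_filterlim[rotated])
  \<comment> \<open>\<open>G\<close> is only known to be continuous. Near x, \<open>?h\<close> after
    \<open>G\<close> and the differentiable \<open>F\<close> after \<open>?h\<close> lift the same
    map, so they differ by a constant and \<open>G\<close> inherits a derivative.\<close>
  then have "\<forall>\<^sub>F y in nhds x. phase_cover (?h (G y)) = phase_cover (F (?h y))"
    by eventually_elim (simp add: phase_cover_helix G(2))
  then have "\<forall>\<^sub>F y in nhds x. ?h (G y) = F (?h y) + (?h (G x) - F (?h x))"
    using local_lifts_differ_by_constant[OF lattice_cover_phase contGh has_derivative_continuous[OF DFh]]
    by blast
  then have ev: "\<forall>\<^sub>F y in nhds x. F (?h y) + (?h (G x) - F (?h x)) = ?h (G y)"
    by eventually_elim simp
  have DhG: "((\<lambda>y. ?h (G y)) has_derivative (\<lambda>u. B (?h' (x $ 3) u))) (at x)"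
    by (rule has_derivative_cong_nhds[OF _ ev]) (use DFh in \<open>auto intro!: derivative_eq_intros\<close>)
  define G' where "G' = (\<lambda>u. fst (B (?h' (x $ 3) u)))"
  have DG: "(G has_derivative G') (at x)"
    using has_derivative_fst[OF DhG] by (simp add: fst_coil_lift G'_def)
  have chain: "B (?h' (x $ 3) u) = ?h' (G x $ 3) (G' u)" for u
    using has_derivative_unique[OF DhG has_derivative_compose[OF DG Dh]] by metis
  have form: "omega (?h' (G x $ 3) (G' u)) (?h' (G x $ 3) (G' v)) = omega (?h' (x $ 3) u) (?h' (x $ 3) v)" for u v
    by (simp add: sympl flip: chain)
  have linG: "linear G'"
    using DG by (rule has_derivative_linear)
  have linB: "linear B"
    using B by (rule has_derivative_linear)
  \<comment> \<open>A symplectic \<open>B\<close> kills no nonzero vector, so \<open>G'\<close> is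
    injective and, by equality of dimensions, onto. The image of the heading is then tested against
    every tangent vector \<open>v\<close> of the torus at the image point.\<close>
  have "inj G'"
    unfolding linear_injective_0[OF linG]
  proof (intro allI impI)
    fix u assume "G' u = 0"
    then have "B (?h' (x $ 3) u) = 0"
      by (simp add: chain) (simp add: coil_deriv_def vec_eq_iff forall_3 prod_eq_iff)
    then have "omega (?h' (x $ 3) u) Y = omega 0 Y" for Y
      using sympl[of "?h' (x $ 3) u" Y] by (simp add: omega_alt)
    then have "?h' (x $ 3) u = 0"
      by (rule omega_nondegenerate)
    then show "u = 0"
      by (auto simp: coil_deriv_def vec_eq_iff forall_3 prod_eq_iff)
  qed
  then have surj: "surj G'"
    using linear_injective_imp_surjective[OF linG] by blast
  let ?z = "G' (heading (x $ 3))" and ?C = "cos (2 * pi * G x $ 3)" and ?S = "sin (2 * pi * G x $ 3)"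
  have ker: "(?z $ 2 * ?C - ?z $ 1 * ?S) * v $ 3 - ?z $ 3 * (v $ 2 * ?C - v $ 1 * ?S) = 0" for v :: "real^3"
  proof -
    obtain u where "v = G' u" using surj by blast
    then have "omega (?h' (G x $ 3) ?z) (?h' (G x $ 3) v) = 0"
      by (simp add: form) (simp add: omega_coil_deriv heading_def)
    then show ?thesis by (simp add: omega_coil_deriv)
  qed
  \<comment> \<open>The horizontal vector perpendicular to the new heading isolates
    \<open>?z $ 3\<close>; the third axis then isolates the parallelism condition.\<close>
  have "?z $ 3 * (?C * ?C + ?S * ?S) = 0"
    using ker[of "vector [- ?S, ?C, 0]"] by (simp add: algebra_simps)
  moreover have "?C * ?C + ?S * ?S = 1"
    using sin_cos_squared_add3[of "2 * pi * G x $ 3"] by simp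
  ultimately have "?z $ 3 = 0" by simp
  moreover have "?z $ 2 * ?C = ?z $ 1 * ?S"
    using ker[of "vector [0, 0, 1]"] by simp
  ultimately show ?thesis
    using that DG by blast
qed

text \<open>The heading is the same all along the line, since the third coordinate does not change.
  The derivative of \<open>G\<close> along it follows the new heading, so \<open>G $ 3\<close> is
  constant; this fixes the new heading and its normal \<open>W x\<close>, after which the normal
  component is constant too.\<close>

lemma symplectic_lift_lines:
  assumes f: "symplectic_diffeo f"
    and G: "continuous_on UNIV G" "\<And>x. helix (torus_cover (G x)) = f (helix (torus_cover x))"
  defines "W \<equiv> \<lambda>x. vector [- sin (2 * pi * G x $ 3), cos (2 * pi * G x $ 3), 0] :: real^3"
  shows "G (x + t *\<^sub>R heading (x $ 3)) $ 3 = G x $ 3"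
    and "W x \<bullet> G (x + t *\<^sub>R heading (x $ 3)) = W x \<bullet> G x"
proof -
  let ?g = "\<lambda>t. x + t *\<^sub>R heading (x $ 3)"
  have "\<exists>z. ((\<lambda>t. G (?g t)) has_derivative (\<lambda>h. h *\<^sub>R z)) (at t) \<and> z $ 3 = 0 \<and>
      z $ 2 * cos (2 * pi * G (?g t) $ 3) = z $ 1 * sin (2 * pi * G (?g t) $ 3)" for t
  proof -
    have g3: "?g t $ 3 = x $ 3"
      by (simp add: heading_def)
    obtain G' where G': "(G has_derivative G') (at (?g t))" "G' (heading (x $ 3)) $ 3 = 0"
      "G' (heading (x $ 3)) $ 2 * cos (2 * pi * G (?g t) $ 3) = G' (heading (x $ 3)) $ 1 * sin (2 * pi * G (?g t) $ 3)"
      using symplectic_lift_preserves_heading[OF f G, of "?g t"] unfolding g3 by metis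
    have "(?g has_derivative (\<lambda>h. h *\<^sub>R heading (x $ 3))) (at t)"
      by (auto intro!: derivative_eq_intros)
    from has_derivative_compose[OF this G'(1)]
    have "((\<lambda>t. G (?g t)) has_derivative (\<lambda>h. h *\<^sub>R G' (heading (x $ 3)))) (at t)"
      using has_derivative_linear[OF G'(1)] by (simp add: linear_cmul)
    then show ?thesis using G' by blast
  qed
  then obtain z where z: "\<And>t. ((\<lambda>t. G (?g t)) has_derivative (\<lambda>h. h *\<^sub>R z t)) (at t)"
      "\<And>t. z t $ 3 = 0" "\<And>t. z t $ 2 * cos (2 * pi * G (?g t) $ 3) = z t $ 1 * sin (2 * pi * G (?g t) $ 3)"
    by metis
  have const3: "G (?g t) $ 3 = G (?g 0) $ 3" for t
  proof (rule has_derivative_zero_const)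
    show "((\<lambda>t. G (?g t) $ 3) has_derivative (\<lambda>h. 0)) (at t)" for t
      using bounded_linear.has_derivative[OF bounded_linear_vec_nth[of 3] z(1)] by (simp add: z(2))
  qed
  then show g3: "G (x + t *\<^sub>R heading (x $ 3)) $ 3 = G x $ 3" for t
    by simp
  have "W x \<bullet> z t = 0" for t
    using z(2,3)[of t] by (simp add: W_def inner_vec_def sum_3 g3 mult.commute)
  then have "((\<lambda>t. W x \<bullet> G (?g t)) has_derivative (\<lambda>h. 0)) (at t)" for t
    using has_derivative_inner_right[OF z(1), of "W x" t] by simp
  then have "W x \<bullet> G (?g t) = W x \<bullet> G (?g 0)"
    by (rule has_derivative_zero_const)
  then show "W x \<bullet> G (x + t *\<^sub>R heading (x $ 3)) = W x \<bullet> G x"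
    by simp
qed

section \<open>Growth of lifts along lattice directions\<close>

lemma quasiperiodic_int:
  fixes H :: "'a::real_vector \<Rightarrow> 'b::real_vector"
  assumes "\<And>x. H (x + v) = H x + w"
  shows "H (x + of_int k *\<^sub>R v) = H x + of_int k *\<^sub>R w"
proof (induction k rule: int_induct[where k = 0])
  case (step1 i)
  have "H (x + of_int (i + 1) *\<^sub>R v) = H ((x + of_int i *\<^sub>R v) + v)"
    by (simp add: algebra_simps)
  also have "\<dots> = H (x + of_int i *\<^sub>R v) + w"
    by (rule assms)
  finally show ?case
    by (simp add: step1 algebra_simps)
next
  case (step2 i)
  have "H (x + of_int i *\<^sub>R v) = H ((x + of_int (i - 1) *\<^sub>R v) + v)"
    by (simp add: algebra_simps)
  also have "\<dots> = H (x + of_int (i - 1) *\<^sub>R v) + w"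
    by (rule assms)
  finally show ?case
    using step2 by (simp add: algebra_simps)
qed simp

lemma bounded_affine_const:
  fixes \<alpha> \<beta> K :: real
  assumes "\<And>t. \<bar>\<alpha> + t * \<beta>\<bar> \<le> K"
  shows "\<beta> = 0"
proof (rule ccontr)
  assume "\<beta> \<noteq> 0"
  then show False
    using assms[of "(\<bar>K\<bar> + 1 - \<alpha>) / \<beta>"] by simp
qed

text \<open>
  Modulo a bounded term, a lift grows linearly along each heading; since it maps the line to a
  line in the direction of the new heading, its linear part maps heading to heading.
\<close>

lemma quasiperiodic_growth:
  fixes G :: "real^3 \<Rightarrow> real^3"
  assumes G: "continuous_on UNIV G"
    and m1: "\<And>x. G (x + axis 1 1) = G x + m1" and m2: "\<And>x. G (x + axis 2 1) = G x + m2"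
    and const: "\<And>t. w \<bullet> G (x + t *\<^sub>R heading s) = w \<bullet> G x"
  shows "cos (2 * pi * s) * (w \<bullet> m1) + sin (2 * pi * s) * (w \<bullet> m2) = 0"
proof -
  \<comment> \<open>Subtracting the growth prescribed by \<open>m1\<close> and \<open>m2\<close>
    leaves a function periodic in the first two coordinates. It is bounded on the slice through
    \<open>x\<close>, which the line never leaves.\<close>
  define P where "P = (\<lambda>y. w \<bullet> (G y - (y $ 1) *\<^sub>R m1 - (y $ 2) *\<^sub>R m2))"
  have "continuous_on UNIV P"
    unfolding P_def by (intro continuous_intros G)
  then have "compact (P ` cbox (vector [0, 0, x $ 3]) (vector [1, 1, x $ 3]))"
    by (intro compact_continuous_image compact_cbox) (rule continuous_on_subset, auto)
  then obtain K where K: "\<And>y. y \<in> cbox (vector [0, 0, x $ 3]) (vector [1, 1, x $ 3]) \<Longrightarrow> \<bar>P y\<bar> \<le> K"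
    using compact_imp_bounded bounded_iff by (metis imageI real_norm_def)
  have P1: "P (y + axis 1 1) = P y + 0" and P2: "P (y + axis 2 1) = P y + 0" for y
  proof -
    have ax: "axis 1 (1::real) $ (1::3) = 1" "axis 1 (1::real) $ (2::3) = 0"
      "axis 2 (1::real) $ (1::3) = 0" "axis 2 (1::real) $ (2::3) = 1"
      by (simp_all add: axis_def)
    show "P (y + axis 1 1) = P y + 0" "P (y + axis 2 1) = P y + 0"
      by (simp_all add: P_def m1 m2 ax algebra_simps)
  qed
  have bound: "\<bar>P y\<bar> \<le> K" if "y $ 3 = x $ 3" for y
  proof -
    let ?y = "y + of_int (- \<lfloor>y $ 1\<rfloor>) *\<^sub>R axis 1 1 + of_int (- \<lfloor>y $ 2\<rfloor>) *\<^sub>R axis 2 1"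
    have "P ?y = P y"
      unfolding quasiperiodic_int[where H = P, OF P2] quasiperiodic_int[where H = P, OF P1] by simp
    moreover have "?y \<in> cbox (vector [0, 0, x $ 3]) (vector [1, 1, x $ 3])"
      using that by (simp add: mem_box_cart forall_3 axis_def) linarith
    ultimately show ?thesis using K by metis
  qed
  have "P (x + t *\<^sub>R heading s) =
      P x + t * (- (cos (2 * pi * s) * (w \<bullet> m1) + sin (2 * pi * s) * (w \<bullet> m2)))" for t
    using const[of t] by (simp add: P_def heading_def inner_diff_right algebra_simps)
  moreover have "(x + t *\<^sub>R heading s) $ 3 = x $ 3" for t
    by (simp add: heading_def)
  ultimately have "\<bar>P x + t * (- (cos (2 * pi * s) * (w \<bullet> m1) + sin (2 * pi * s) * (w \<bullet> m2)))\<bar> \<le> K" for t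
    using bound by metis
  then show ?thesis
    using bounded_affine_const by fastforce
qed

text \<open>Translation of the argument by a period gives another lift of the same map, so the
  increment does not depend on x, and it lies in the lattice.\<close>

lemma lift_translation:
  assumes G: "continuous_on UNIV G" "\<And>x. torus_cover (G x) = \<psi> (torus_cover x)"
    and "torus_cover v = torus_cover 0"
  obtains m where "\<And>x. G (x + v) = G x + m" "\<And>i. m $ i \<in> \<int>"
proof -
  have tr: "torus_cover (x + v) = torus_cover x" for x
    using torus_cover_translate[of 0 v x] assms(3) by simp
  have "continuous_on UNIV (\<lambda>x. G (x + v))"
    by (intro continuous_on_compose2[OF G(1)] continuous_intros) auto
  then have "G (x + v) - G x = G (0 + v) - G 0" for x
    by (rule continuous_torus_lifts_constant[OF _ G(1)]) (simp add: G(2) tr)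
  then have "G (x + v) = G x + (G (0 + v) - G 0)" for x
    by (metis add.commute diff_add_cancel)
  moreover have "(G (0 + v) - G 0) $ i \<in> \<int>" for i
    using tr[of 0] torus_cover_eq_iff[of "G (0 + v)" "G 0"] by (simp add: G(2))
  ultimately show ?thesis by (rule that)
qed

lemma helix_lift:
  assumes "smooth_map phase_cover phase_cover f"
  obtains G where "continuous_on UNIV G" "\<And>x. torus_cover (G x) = fst (f (helix (torus_cover x)))"
proof -
  have "continuous_on UNIV (coil_lift 1 0 1)"
    by (intro continuous_at_imp_continuous_on ballI has_derivative_continuous[OF
        coil_lift_has_derivative[OF has_derivative_ident]])
  then have "continuous_on UNIV (\<lambda>x. f (phase_cover (coil_lift 1 0 1 x)))"
    by (rule continuous_on_compose2[OF smooth_map_continuous[OF assms continuous_on_phase_cover]]) simp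
  then have "continuous_on UNIV (\<lambda>x. fst (f (helix (torus_cover x))))"
    by (simp add: phase_cover_helix continuous_on_fst)
  then show ?thesis
    using torus_lift that by blast
qed

section \<open>The action on directions and the invariant closed set\<close>

definition angle_dir :: "torus3 \<Rightarrow> real \<times> real" where
  "angle_dir \<theta> = (cos_2pi (\<theta> $ 3), sin_2pi (\<theta> $ 3))"

lemma angle_dir_torus_cover:
  "angle_dir (torus_cover x) = (cos (2 * pi * x $ 3), sin (2 * pi * x $ 3))"
  by (simp add: angle_dir_def)

lemma symplectic_helix_direction:
  assumes f: "symplectic_diffeo f" and inv_torus: "f ` helix_torus = helix_torus"
  obtains a b c d :: int where "\<bar>a * d - b * c\<bar> = 1"
    "\<And>\<theta>. parallel (lin2 a b c d (angle_dir \<theta>)) (angle_dir (fst (f (helix \<theta>))))"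
proof -
  have fh: "helix (fst (f (helix \<theta>))) = f (helix \<theta>)" for \<theta>
  proof -
    have "f (helix \<theta>) \<in> helix_torus"
      using inv_torus by (auto simp: helix_torus_def)
    then show ?thesis
      by (auto simp: helix_torus_def)
  qed
  have bij: "bij f" using f by (simp add: symplectic_diffeo_def)
  obtain G where G: "continuous_on UNIV G" "\<And>x. torus_cover (G x) = fst (f (helix (torus_cover x)))"
    using f by (auto simp: symplectic_diffeo_def elim: helix_lift)
  obtain H where H: "continuous_on UNIV H" "\<And>x. torus_cover (H x) = fst (inv f (helix (torus_cover x)))"
    using f by (auto simp: symplectic_diffeo_def elim: helix_lift)
  have G2: "helix (torus_cover (G x)) = f (helix (torus_cover x))" for x
    by (simp add: G(2) fh)
  have axis_lattice: "torus_cover (axis i 1) = torus_cover 0" for i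
    by (auto simp: torus_cover_eq_iff axis_def)
  obtain m1 m2 where m1: "\<And>x. G (x + axis 1 1) = G x + m1" "\<And>i. m1 $ i \<in> \<int>"
    and m2: "\<And>x. G (x + axis 2 1) = G x + m2" "\<And>i. m2 $ i \<in> \<int>"
    using lift_translation[of G "\<lambda>\<theta>. fst (f (helix \<theta>))", OF G axis_lattice] by metis
  obtain n1 n2 where n1: "\<And>x. H (x + axis 1 1) = H x + n1" "\<And>i. n1 $ i \<in> \<int>"
    and n2: "\<And>x. H (x + axis 2 1) = H x + n2" "\<And>i. n2 $ i \<in> \<int>"
    using lift_translation[of H "\<lambda>\<theta>. fst (inv f (helix \<theta>))", OF H axis_lattice] by metis
  obtain a b c d :: int where abcd: "m1 $ 1 = a" "m1 $ 2 = b" "m2 $ 1 = c" "m2 $ 2 = d"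
    using m1(2) m2(2) by (metis Ints_cases)
  obtain a' b' c' d' :: int where abcd': "n1 $ 1 = a'" "n1 $ 2 = b'" "n2 $ 1 = c'" "n2 $ 2 = d'"
    using n1(2) n2(2) by (metis Ints_cases)
  have third: "cos (2 * pi * x $ 3) * m1 $ 3 + sin (2 * pi * x $ 3) * m2 $ 3 = 0" for x :: "real^3"
  proof -
    have "axis 3 1 \<bullet> G (x + t *\<^sub>R heading (x $ 3)) = axis 3 1 \<bullet> G x" for t
      using symplectic_lift_lines(1)[OF f G(1) G2] by (simp add: inner_axis')
    from quasiperiodic_growth[OF G(1) m1(1) m2(1) this] show ?thesis
      by (simp add: inner_axis')
  qed
  \<comment> \<open>The headings at third angle 0 and 1/4 are the first two coordinate directions,
    so each increment is tested separately.\<close>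
  have m3: "m1 $ 3 = 0" "m2 $ 3 = 0"
    using third[of 0] third[of "axis 3 (1/4)"] by simp_all
  have "parallel (lin2 a b c d (angle_dir \<theta>)) (angle_dir (fst (f (helix \<theta>))))" for \<theta>
  proof -
    obtain x where \<theta>: "\<theta> = torus_cover x" by (rule torus_cases)
    \<comment> \<open>Taking for \<open>w\<close> the normal to the new heading, vanishing growth
      says that the matrix sends the old heading into the new direction.\<close>
    from quasiperiodic_growth[OF G(1) m1(1) m2(1) symplectic_lift_lines(2)[OF f G(1) G2, of x]]
    show ?thesis
      unfolding \<theta> G(2)[symmetric] angle_dir_torus_cover
      by (simp add: parallel_def lin2_def inner_vec_def sum_3 abcd algebra_simps)
  qed
  moreover have "\<bar>a * d - b * c\<bar> = 1"
  proof -
    have HG: "torus_cover (H (G x)) = torus_cover x" for x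
      by (simp add: H(2) G2 inv_f_f[OF bij_is_inj[OF bij]])
    have "continuous_on UNIV (\<lambda>x. H (G x))"
      by (rule continuous_on_compose2[OF H(1) G(1)]) simp
    \<comment> \<open>\<open>H\<close> after \<open>G\<close> lifts the identity, so it commutes
      with every translation. The increments \<open>m1\<close> and \<open>m2\<close> have third
      entry 0, so \<open>H\<close> shifts by combinations of \<open>n1\<close> and \<open>n2\<close>
      under them. Comparing the first two entries shows that the two integer matrices are inverse to
      each other, so the determinant is a unit.\<close>
    then have shift: "H (G (x + v)) - (x + v) = H (G x) - x" for x v
      by (rule continuous_torus_lifts_constant[OF _ continuous_on_id]) (rule HG)
    have Hint: "H (x + m) = H x + of_int p *\<^sub>R n1 + of_int q *\<^sub>R n2"
      if "m $ 1 = of_int p" "m $ 2 = of_int q" "m $ 3 = 0" for x m p q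
    proof -
      have "m = of_int p *\<^sub>R axis 1 1 + of_int q *\<^sub>R axis 2 1"
        using that by (simp add: vec_eq_iff forall_3 axis_def)
      then have "H (x + m) = H ((x + of_int p *\<^sub>R axis 1 1) + of_int q *\<^sub>R axis 2 1)"
        by (simp add: add.assoc)
      then show ?thesis
        by (simp add: quasiperiodic_int[where H = H, OF n1(1)] quasiperiodic_int[where H = H, OF n2(1)])
    qed
    have "H (G 0 + m1) - axis 1 1 = H (G 0)"
      using shift[of 0 "axis 1 1"] m1(1)[of 0] by simp
    then have "of_int a *\<^sub>R n1 + of_int b *\<^sub>R n2 = axis 1 1"
      unfolding Hint[OF abcd(1,2) m3(1)] by (simp add: diff_eq_eq add.assoc)
    then have "real_of_int (a * a' + b * c') = of_int 1" "real_of_int (a * b' + b * d') = of_int 0"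
      using abcd' by (auto simp: vec_eq_iff forall_3 axis_def)
    then have i1: "a * a' + b * c' = 1" "a * b' + b * d' = 0"
      unfolding of_int_eq_iff .
    have "H (G 0 + m2) - axis 2 1 = H (G 0)"
      using shift[of 0 "axis 2 1"] m2(1)[of 0] by simp
    then have "of_int c *\<^sub>R n1 + of_int d *\<^sub>R n2 = axis 2 1"
      unfolding Hint[OF abcd(3,4) m3(2)] by (simp add: diff_eq_eq add.assoc)
    then have "real_of_int (c * a' + d * c') = of_int 0" "real_of_int (c * b' + d * d') = of_int 1"
      using abcd' by (auto simp: vec_eq_iff forall_3 axis_def)
    then have i2: "c * a' + d * c' = 0" "c * b' + d * d' = 1"
      unfolding of_int_eq_iff .
    have "(a * d - b * c) * (a' * d' - b' * c') =
        (a * a' + b * c') * (c * b' + d * d') - (a * b' + b * d') * (c * a' + d * c')"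
      by (simp add: algebra_simps)
    then have "(a * d - b * c) * (a' * d' - b' * c') = 1"
      by (simp add: i1 i2)
    then show ?thesis
      using zmult_eq_1_iff[of "a * d - b * c"] by auto
  qed
  ultimately show ?thesis by (rule that[rotated])
qed

lemma angle_dir_nonzero: "angle_dir \<theta> \<noteq> 0"
proof -
  have "\<theta> = torus_cover x \<Longrightarrow> ?thesis" for x
    using sin_zero_abs_cos_one[of "2 * pi * x $ 3"] by (auto simp: angle_dir_torus_cover zero_prod_def)
  then show ?thesis by (rule torus_cases[of \<theta>])
qed

lemma angle_dir_parallel_exists:
  assumes "w \<noteq> 0"
  obtains \<theta> where "parallel w (angle_dir \<theta>)"
proof -
  obtain u v where w: "w = (u, v)" by (cases w)
  define n where "n = sqrt (u\<^sup>2 + v\<^sup>2)"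
  have pos: "u\<^sup>2 + v\<^sup>2 > 0"
    using assms by (auto simp: w zero_prod_def sum_power2_gt_zero_iff)
  have "n > 0"
    unfolding n_def using pos by (rule real_sqrt_gt_zero)
  then have "n \<noteq> 0" by simp
  have n2: "n\<^sup>2 = u\<^sup>2 + v\<^sup>2"
    by (simp add: n_def)
  have "(u / n)\<^sup>2 + (v / n)\<^sup>2 = (u\<^sup>2 + v\<^sup>2) / n\<^sup>2"
    by (simp add: power_divide add_divide_distrib)
  also have "\<dots> = 1"
    unfolding n2 by (rule divide_self[OF less_imp_neq[OF pos, symmetric]])
  finally have "(u / n)\<^sup>2 + (v / n)\<^sup>2 = 1" .
  then obtain t where "u / n = cos t" "v / n = sin t"
    using sincos_total_2pi by metis
  then have t: "u = n * cos t" "v = n * sin t"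
    using \<open>n \<noteq> 0\<close> by (auto simp: field_simps)
  show ?thesis
    by (rule that[of "torus_cover (axis 3 (t / (2 * pi)))"])
       (simp only: angle_dir_torus_cover, simp add: parallel_def w t)
qed

text \<open>The vectors (1, m) are pairwise non-parallel, so each nonzero \<open>w\<close> is
  parallel to at most one of them and infinitely many directions remain.\<close>

lemma angle_dir_avoids_finite:
  assumes "finite W" "0 \<notin> W"
  obtains \<theta> where "\<And>w. w \<in> W \<Longrightarrow> \<not> parallel w (angle_dir \<theta>)"
proof -
  let ?M = "\<lambda>w. {m::nat. parallel w (1, of_nat m)}"
  have "finite (?M w)" if "w \<in> W" for w
  proof -
    have "m = m'" if "m \<in> ?M w" "m' \<in> ?M w" for m m'
      using parallel_trans[of w "(1, real m)" "(1, real m')"] that \<open>w \<in> W\<close> assms(2)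
      by (auto simp: parallel_def)
    then have "?M w \<subseteq> {m}" if "m \<in> ?M w" for m
      using that by blast
    then show ?thesis
      by (metis finite.emptyI finite_insert finite_subset ex_in_conv)
  qed
  then have "finite (\<Union>w\<in>W. ?M w)"
    using assms(1) by blast
  then obtain m where m: "\<And>w. w \<in> W \<Longrightarrow> \<not> parallel w (1, of_nat m)"
    using ex_new_if_finite[OF infinite_UNIV_nat] by blast
  obtain \<theta> where \<theta>: "parallel (1, of_nat m) (angle_dir \<theta>)"
    by (rule angle_dir_parallel_exists[of "(1, real m)"]) (auto simp: zero_prod_def)
  have "\<not> parallel w (angle_dir \<theta>)" if "w \<in> W" for w
    using parallel_trans[OF parallel_sym parallel_sym[OF \<theta>] angle_dir_nonzero] m[OF that] by blast
  then show ?thesis by (rule that)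
qed

lemma orbit_subset:
  assumes "bij f" "x \<in> Q" "f ` Q = Q"
  shows "orbit f x \<subseteq> Q"
proof -
  have fQ: "f z \<in> Q" if "z \<in> Q" for z using that assms(3) by blast
  have iQ: "inv f z \<in> Q" if "z \<in> Q" for z
    using that assms(3) inv_f_f[OF bij_is_inj[OF assms(1)]] by (metis imageE)
  have "(f ^^ n) x \<in> Q" "(inv f ^^ n) x \<in> Q" for n
    using assms(2) fQ iQ by (induction n) auto
  then show ?thesis by (auto simp: orbit_def)
qed

lemma symplectic_not_minimal_helix:
  assumes f: "symplectic_diffeo f" and inv_torus: "f ` helix_torus = helix_torus"
  shows "\<not> minimal_on f helix_torus"
proof
  assume min: "minimal_on f helix_torus"
  obtain a b c d :: int where det: "\<bar>a * d - b * c\<bar> = 1"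
    and dir: "\<And>\<theta>. parallel (lin2 a b c d (angle_dir \<theta>)) (angle_dir (fst (f (helix \<theta>))))"
    by (rule symplectic_helix_direction[OF assms]) blast
  let ?A = "lin2 a b c d"
  have det0: "a * d - b * c \<noteq> 0" using det by auto
  obtain W where W: "finite W" "W \<noteq> {}" "0 \<notin> W"
    and fwd: "\<And>w. w \<in> W \<Longrightarrow> \<exists>w'\<in>W. parallel (?A w) w'"
    and bwd: "\<And>w. w \<in> W \<Longrightarrow> \<exists>w'\<in>W. parallel (?A w') w"
    using finite_invariant_directions[OF det] by blast
  define Q where "Q = {z :: phase. \<exists>w\<in>W. parallel w (angle_dir (fst z))}"
  have "closed {z :: phase. parallel w (angle_dir (fst z))}" for w
    unfolding parallel_def angle_dir_def fst_conv snd_conv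
    by (intro closed_Collect_eq continuous_intros continuous_on_compose2[OF continuous_on_cos_2pi]
        continuous_on_compose2[OF continuous_on_sin_2pi] continuous_on_component) auto
  moreover have "Q = (\<Union>w\<in>W. {z. parallel w (angle_dir (fst z))})"
    by (auto simp: Q_def)
  ultimately have "closed Q"
    using W(1) by auto
  \<comment> \<open>Orbits contain backward iterates, so membership must be reflected as well as
    preserved: \<open>fwd\<close> keeps points in \<open>Q\<close>, while \<open>bwd\<close> and the
    injectivity of the matrix on directions pull them back.\<close>
  have step: "f (helix \<theta>) \<in> Q \<longleftrightarrow> helix \<theta> \<in> Q" for \<theta>
  proof
    assume "helix \<theta> \<in> Q"
    then obtain w where w: "w \<in> W" "parallel w (angle_dir \<theta>)" by (auto simp: Q_def)
    obtain w' where w': "w' \<in> W" "parallel (?A w) w'" using fwd w(1) by blast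
    have "w \<noteq> 0" using w(1) W(3) by blast
    have "parallel (?A w) (?A (angle_dir \<theta>))"
      using w(2) parallel_lin2[OF det0] by blast
    then have "parallel (?A (angle_dir \<theta>)) w'"
      using parallel_trans w'(2) lin2_nonzero[OF det0 \<open>w \<noteq> 0\<close>] by blast
    then have "parallel w' (angle_dir (fst (f (helix \<theta>))))"
      using parallel_trans dir lin2_nonzero[OF det0 angle_dir_nonzero] by blast
    then show "f (helix \<theta>) \<in> Q" using w'(1) by (auto simp: Q_def)
  next
    assume "f (helix \<theta>) \<in> Q"
    then obtain w where w: "w \<in> W" "parallel w (angle_dir (fst (f (helix \<theta>))))" by (auto simp: Q_def)
    obtain w' where w': "w' \<in> W" "parallel (?A w') w" using bwd w(1) by blast
    have "w \<noteq> 0" using w(1) W(3) by blast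
    then have "parallel (?A w') (angle_dir (fst (f (helix \<theta>))))"
      using parallel_trans parallel_sym w'(2) w(2) by blast
    then have "parallel (?A w') (?A (angle_dir \<theta>))"
      using parallel_trans parallel_sym dir angle_dir_nonzero by blast
    then have "parallel w' (angle_dir \<theta>)"
      using parallel_lin2[OF det0] by blast
    then show "helix \<theta> \<in> Q" using w'(1) by (auto simp: Q_def)
  qed
  have "f ` (Q \<inter> helix_torus) = Q \<inter> helix_torus"
  proof
    show "f ` (Q \<inter> helix_torus) \<subseteq> Q \<inter> helix_torus"
      using step inv_torus by (auto simp: helix_torus_def)
    show "Q \<inter> helix_torus \<subseteq> f ` (Q \<inter> helix_torus)"
    proof
      fix z assume z: "z \<in> Q \<inter> helix_torus"
      then obtain \<theta> where "z = f (helix \<theta>)"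
        using inv_torus unfolding helix_torus_def by blast
      then show "z \<in> f ` (Q \<inter> helix_torus)"
        using z step by (auto simp: helix_torus_def)
    qed
  qed
  obtain w where "w \<in> W" "w \<noteq> 0" using W(2,3) by blast
  then obtain \<theta> where "parallel w (angle_dir \<theta>)"
    using angle_dir_parallel_exists by blast
  then have \<theta>: "helix \<theta> \<in> Q"
    using \<open>w \<in> W\<close> by (auto simp: Q_def)
  have "orbit f (helix \<theta>) \<subseteq> Q \<inter> helix_torus"
    using f \<theta> \<open>f ` (Q \<inter> helix_torus) = Q \<inter> helix_torus\<close>
    by (intro orbit_subset) (auto simp: symplectic_diffeo_def helix_torus_def)
  then have "closure (orbit f (helix \<theta>)) \<subseteq> Q"
    using \<open>closed Q\<close> by (intro closure_minimal) auto
  then have "helix_torus \<subseteq> Q"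
    using min unfolding minimal_on_def helix_torus_def by blast
  moreover obtain \<theta>' where "\<And>w. w \<in> W \<Longrightarrow> \<not> parallel w (angle_dir \<theta>')"
    using angle_dir_avoids_finite[OF W(1,3)] by blast
  then have "helix \<theta>' \<notin> Q" by (auto simp: Q_def)
  ultimately show False by (auto simp: helix_torus_def)
qed

theorem proposition1:
  shows
    "(torus_embedding helix \<and>
      flow_invariant (hamiltonian_flow kinetic) helix_torus \<and>
      \<not> lagrangian helix_torus \<and>
      no_conjugate_points (hamiltonian_flow kinetic) helix_torus)
   \<and> (\<exists>S S'.
      (\<forall>T\<in>{S, S'}.
         embedded_torus T \<and>
         flow_invariant (hamiltonian_flow kinetic) T \<and>
         no_conjugate_points (hamiltonian_flow kinetic) T \<and>
         \<not> lagrangian T \<and>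
         \<not> is_graph T) \<and>
      isotopic_tori S zero_section \<and>
      \<not> isotopic_tori S' zero_section)
   \<and> (\<forall>f. symplectic_diffeo f \<and> f ` helix_torus = helix_torus \<longrightarrow>
      \<not> minimal_on f helix_torus)"
proof (intro conjI)
  have emb: "torus_embedding (coil a c 1)" for a c
    by (simp add: torus_embedding_coil)
  have coil: "embedded_torus (range (coil a c 1))"
      "flow_invariant (hamiltonian_flow kinetic) (range (coil a c 1))"
      "no_conjugate_points (hamiltonian_flow kinetic) (range (coil a c 1))"
      "\<not> lagrangian (range (coil a c 1))" for a c
    using emb by (auto simp: embedded_torus_def hamiltonian_flow_kinetic
        flow_invariant_coil no_conjugate_points_free_flow coil_not_lagrangian)
  show "torus_embedding helix" "flow_invariant (hamiltonian_flow kinetic) helix_torus"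
    "\<not> lagrangian helix_torus" "no_conjugate_points (hamiltonian_flow kinetic) helix_torus"
    using coil emb by (simp_all add: helix_torus_def helix_eq_coil)
  show "\<exists>S S'.
      (\<forall>T\<in>{S, S'}.
         embedded_torus T \<and>
         flow_invariant (hamiltonian_flow kinetic) T \<and>
         no_conjugate_points (hamiltonian_flow kinetic) T \<and>
         \<not> lagrangian T \<and>
         \<not> is_graph T) \<and>
      isotopic_tori S zero_section \<and>
      \<not> isotopic_tori S' zero_section"
    by (intro exI[of _ "range (coil 1 (1/4) 1)"] exI[of _ "range (coil 0 0 1)"])
       (simp add: coil coil_0_not_graph coil_quarter_not_graph isotopic_coil_zero_section
          coil_0_not_isotopic_zero_section)
  show "\<forall>f. symplectic_diffeo f \<and> f ` helix_torus = helix_torus \<longrightarrow> \<not> minimal_on f helix_torus"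
    using symplectic_not_minimal_helix by blast
qed

end
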